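(* Let $A$, $B$, $A_1$, $B_1$, $C_1$, $C_1-B_1$ and $\mathbb{Y}$ be positive stable matrices in $\mathbb{C}^{r\times r}$ with $B_1C_1=C_1B_1$, and let $z\in\mathbb{C}$ with $|z|<1$. Then $${}_2F_1^{(A,B;\mathbb{Y})}(A_1,B_1;C_1;z)=\int_0^1(1-zt)^{-A_1}\,{}_1F_1\!\left(A;B;-\frac{\mathbb{Y}}{t(1-t)}\right)t^{B_1-I}(1-t)^{C_1-B_1-I}\,dt\;[\mathfrak{B}(B_1,C_1-B_1)]^{-1}$$ and $${}_2F_1^{(A,B;\mathbb{Y})}(A_1,B_1;C_1;z)=\int_0^\infty(1+u(1-z))^{-A_1}(1+u)^{A_1}\,{}_1F_1\!\left(A;B;-2\mathbb{Y}-\mathbb{Y}\left(u+\frac1u\right)\right)u^{B_1-I}(1+u)^{-C_1}\,du\;[\mathfrak{B}(B_1,C_1-B_1)]^{-1}.$$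
   Context: A matrix in $\mathbb{C}^{r\times r}$ is positive stable if all its eigenvalues have positive real part; $I$ is the identity matrix. For a matrix $M$ and a complex number $s\notin(-\infty,0]$, $s^M=\exp(M\log s)$ with the principal logarithm. The Pochhammer symbol is $(M)_0=I$, $(M)_n=M(M+I)\cdots(M+(n-1)I)$ for $n\ge1$. For positive stable $B$ and a square matrix $W$, ${}_1F_1(A;B;W)=\sum_{n\ge0}(A)_n\,[(B)_n]^{-1}\,\frac{W^n}{n!}$. For commuting positive stable $P,Q$, the beta matrix function is $\mathfrak{B}(P,Q)=\Gamma(P)\Gamma(Q)\Gamma^{-1}(P+Q)=\int_0^1t^{P-I}(1-t)^{Q-I}dt$, where $\Gamma(P)=\int_0^\infty e^{-t}t^{P-I}dt$. For positive stable $A,B,P,Q,\mathbb{Y}$, $$\mathfrak{B}_{\mathbb{Y}}^{(A,B)}(P,Q)=\int_0^1 {}_1F_1\!\left(A;B;-\frac{\mathbb{Y}}{t(1-t)}\right)t^{P-I}(1-t)^{Q-I}\,dt .$$ The new extended Gauss hypergeometric matrix function is $${}_2F_1^{(A,B;\mathbb{Y})}(A_1,B_1;C_1;z)=\sum_{n=0}^\infty (A_1)_n\,\mathfrak{B}_{\mathbb{Y}}^{(A,B)}(B_1+nI,C_1-B_1)\,[\mathfrak{B}(B_1,C_1-B_1)]^{-1}\,\frac{z^n}{n!}.$$ *)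

theory Defs
  imports "HOL-Analysis.Analysis"
begin

text \<open>
  Square complex matrices are elements of \<open>complex^'n^'n\<close>. On this type the library's \<open>*\<close>,
  \<open>^\<close>, \<open>1\<close> and \<open>inverse\<close> are not the matrix operations (\<open>*\<close> is entrywise), so products are
  written \<open>**\<close>, the identity is \<open>mat 1\<close>, inverses are \<open>matrix_inv\<close>, and powers and the
  exponential are defined here. The topology is that of the entrywise (Euclidean) norm.
\<close>

definition cscale :: "complex \<Rightarrow> complex^'n^'n \<Rightarrow> complex^'n^'n"  (infixr \<open>*\<^sub>c\<close> 75)
  where "c *\<^sub>c M = (\<chi> i j. c * M $ i $ j)"

definition positive_stable :: "complex^'n^'n \<Rightarrow> bool" where
  "positive_stable M \<longleftrightarrow> (\<forall>k v. v \<noteq> 0 \<and> M *v v = k *s v \<longrightarrow> Re k > 0)"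

primrec mat_power :: "complex^'n^'n \<Rightarrow> nat \<Rightarrow> complex^'n^'n" where
  "mat_power M 0 = mat 1"
| "mat_power M (Suc n) = mat_power M n ** M"

definition mat_exp :: "complex^'n^'n \<Rightarrow> complex^'n^'n" where
  "mat_exp M = (\<Sum>n. mat_power M n /\<^sub>R fact n)"

text \<open>\<open>cpow_mat s M\<close> is $s^M$, with the principal branch \<open>Ln\<close>; it is meant for \<open>s \<notin> \<real>\<^sub>\<le>\<^sub>0\<close>.\<close>

definition cpow_mat :: "complex \<Rightarrow> complex^'n^'n \<Rightarrow> complex^'n^'n" where
  "cpow_mat s M = mat_exp (Ln s *\<^sub>c M)"

primrec mat_pochhammer :: "complex^'n^'n \<Rightarrow> nat \<Rightarrow> complex^'n^'n" where
  "mat_pochhammer M 0 = mat 1"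
| "mat_pochhammer M (Suc n) = mat_pochhammer M n ** (M + mat (of_nat n))"

definition hyp1F1_mat :: "complex^'n^'n \<Rightarrow> complex^'n^'n \<Rightarrow> complex^'n^'n \<Rightarrow> complex^'n^'n" where
  "hyp1F1_mat A B W =
     (\<Sum>n. (mat_pochhammer A n ** matrix_inv (mat_pochhammer B n) ** mat_power W n) /\<^sub>R fact n)"

definition Gamma_mat :: "complex^'n^'n \<Rightarrow> complex^'n^'n" where
  "Gamma_mat P = integral {0<..} (\<lambda>t::real. exp (- t) *\<^sub>R cpow_mat (of_real t) (P - mat 1))"

definition Beta_mat :: "complex^'n^'n \<Rightarrow> complex^'n^'n \<Rightarrow> complex^'n^'n" where
  "Beta_mat P Q = Gamma_mat P ** Gamma_mat Q ** matrix_inv (Gamma_mat (P + Q))"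

definition ext_Beta_mat ::
  "complex^'n^'n \<Rightarrow> complex^'n^'n \<Rightarrow> complex^'n^'n \<Rightarrow> complex^'n^'n \<Rightarrow> complex^'n^'n \<Rightarrow> complex^'n^'n"
  where
  "ext_Beta_mat A B Y P Q =
     integral {0<..<1} (\<lambda>t::real.
       hyp1F1_mat A B (- (Y /\<^sub>R (t * (1 - t))))
         ** cpow_mat (of_real t) (P - mat 1)
         ** cpow_mat (of_real (1 - t)) (Q - mat 1))"

definition ext_hyp2F1_term ::
  "complex^'n^'n \<Rightarrow> complex^'n^'n \<Rightarrow> complex^'n^'n \<Rightarrow>
   complex^'n^'n \<Rightarrow> complex^'n^'n \<Rightarrow> complex^'n^'n \<Rightarrow> complex \<Rightarrow> nat \<Rightarrow> complex^'n^'n"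
  where
  "ext_hyp2F1_term A B Y A1 B1 C1 z n =
     (z ^ n / fact n) *\<^sub>c
       (mat_pochhammer A1 n ** ext_Beta_mat A B Y (B1 + mat (of_nat n)) (C1 - B1)
          ** matrix_inv (Beta_mat B1 (C1 - B1)))"

definition ext_hyp2F1 ::
  "complex^'n^'n \<Rightarrow> complex^'n^'n \<Rightarrow> complex^'n^'n \<Rightarrow>
   complex^'n^'n \<Rightarrow> complex^'n^'n \<Rightarrow> complex^'n^'n \<Rightarrow> complex \<Rightarrow> complex^'n^'n"
  where
  "ext_hyp2F1 A B Y A1 B1 C1 z = (\<Sum>n. ext_hyp2F1_term A B Y A1 B1 C1 z n)"

end

theory Submission
  imports Defs "HOL-Computational_Algebra.Fundamental_Theorem_Algebra"
    "HOL-Real_Asymp.Real_Asymp"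
begin

text \<open>
  Termwise integration of the binomial series of $(1 - zt)^{-A_1}$ against the kernel of the extended
  beta function gives the first formula, and $t = u / (1 + u)$ turns it into the second; the Beta
  matrix enters only as a constant right factor. What has to be shown is that the kernel is absolutely
  integrable although its argument $-Y / (t (1 - t))$ is unbounded and $A$, $B$, $Y$ need not commute.

  Positive stability of $P$ yields an inner product $q$ with $q(x, P x) \ge d |x|^2$ for some $d > 0$: the product of
  shifts $P - l$ over eigenvalues $l$ that annihilates $P$ allows one to build $q$ one factor at
  a time. This form gives $|t^{P - I}| \le C t^{d - 1}$ on $(0, 1]$. It also gives boundedness of
  ${}_1F_1(A; B; -sY)$ for $s \ge 1$: with $\theta = s d/ds$, the hypergeometric equation
  $\theta (\theta + B - 1) w = -s Y (\theta + A) w$, written in the variables $w$ and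
  $v = (\theta + A) w$, is a damped linear system.
\<close>

section \<open>Lyapunov forms of positive stable matrices\<close>

text \<open>Termwise estimates cannot bound 1F1(A;B;-sY) for large s: the sum is small by
  cancellation between huge terms, and without common eigenvectors of \<open>A\<close>,
  \<open>B\<close> and \<open>Y\<close> it does not split into scalar series. The differential
  equation sees the cancellation. The variable v is chosen because -sY hits exactly (theta + A) w:
  one gets theta v = (1 + A - B) theta w - s Y v, so that after division by s the unbounded term is
  the pure damping -Yv and everything else carries a factor 1/s. Boundedness without decay suffices,
  since the powers of t and 1 - t already provide an integrable scalar beta majorant.

  The interchange of sum and integral rests on |z| < 1: the norms of (A1)_n z^n / n! are summable,
  so the partial sums of the binomial series are bounded uniformly in t, also near t = 1.

  The power of 1 - zt stays leftmost throughout, as \<open>A1\<close> commutes with no other factor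
  by assumption. Commutation of \<open>B1\<close> and \<open>C1\<close> enters when the substitution
  produces two powers of 1 + u whose exponents must be added.\<close>

lemma bounded_bilinear_matrix_mult:
  "bounded_bilinear ((**) :: complex^'n^'n \<Rightarrow> complex^'n^'n \<Rightarrow> complex^'n^'n)"
proof -
  have "bilinear ((**) :: complex^'n^'n \<Rightarrow> complex^'n^'n \<Rightarrow> complex^'n^'n)"
    unfolding bilinear_def
    by (auto intro!: linearI simp: matrix_add_ldistrib vec_eq_iff matrix_matrix_mult_def
        algebra_simps sum.distrib scaleR_sum_right)
  then show ?thesis
    by (simp add: bilinear_conv_bounded_bilinear)
qed

interpretation mm: bounded_bilinear
  "(**) :: complex^'n^'n \<Rightarrow> complex^'n^'n \<Rightarrow> complex^'n^'n"
  by (rule bounded_bilinear_matrix_mult)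

section \<open>Scalar matrices and powers\<close>

lemma cscale_eq_mat_mult: "c *\<^sub>c M = mat c ** M"
  by (simp add: cscale_def mat_def matrix_matrix_mult_def vec_eq_iff mult_delta_left mult_delta_right)

lemma mat_mult_commute: "M ** mat c = mat c ** (M :: complex^'n^'n)"
  by (simp add: mat_def matrix_matrix_mult_def vec_eq_iff mult_delta_left mult_delta_right mult.commute)

lemma mat_add: "mat (a + b) = (mat a + mat b :: complex^'n^'n)"
  by (simp add: mat_def vec_eq_iff)

lemma mat_minus: "mat (- a) = (- mat a :: complex^'n^'n)"
  by (simp add: mat_def vec_eq_iff)

lemma mat_mult: "mat (a * b) = (mat a ** mat b :: complex^'n^'n)"
  by (simp add: mat_def matrix_matrix_mult_def vec_eq_iff mult_delta_left mult_delta_right)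

lemma mat_of_real: "mat (of_real r) = (r *\<^sub>R mat 1 :: complex^'n^'n)"
  by (simp add: mat_def vec_eq_iff) (simp add: scaleR_conv_of_real)

lemma cscale_of_real: "of_real r *\<^sub>c M = r *\<^sub>R M"
  by (simp add: cscale_eq_mat_mult mat_of_real mm.scaleR_left)

lemma mult_mat_of_nat: "M ** mat (of_nat n) = real n *\<^sub>R (M :: complex^'n^'n)"
  and mat_of_nat_mult: "mat (of_nat n) ** M = real n *\<^sub>R M"
proof -
  have "mat (of_nat n) = (real n *\<^sub>R mat 1 :: complex^'n^'n)"
    using mat_of_real[of "real n"] by simp
  then show "M ** mat (of_nat n) = real n *\<^sub>R M" "mat (of_nat n) ** M = real n *\<^sub>R M"
    by (simp_all add: mm.scaleR_left mm.scaleR_right)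
qed

lemma cscale_add_right: "c *\<^sub>c (M + N) = c *\<^sub>c M + c *\<^sub>c N"
  by (simp add: cscale_eq_mat_mult mm.add_right)

lemma cscale_mult_left: "(c *\<^sub>c M) ** N = c *\<^sub>c (M ** N)"
  by (simp add: cscale_eq_mat_mult matrix_mul_assoc)

lemma cscale_mult_right: "M ** (c *\<^sub>c N) = c *\<^sub>c (M ** N)"
  by (metis cscale_eq_mat_mult mat_mult_commute matrix_mul_assoc)

lemma cscale_cscale: "a *\<^sub>c b *\<^sub>c M = (a * b) *\<^sub>c M"
  by (simp add: cscale_eq_mat_mult matrix_mul_assoc mat_mult)

lemma cscale_scaleR: "c *\<^sub>c (r *\<^sub>R M) = r *\<^sub>R (c *\<^sub>c M)"
  by (simp add: cscale_eq_mat_mult mm.scaleR_right)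

lemma cscale_nth [simp]: "(c *\<^sub>c M) $ i $ j = c * M $ i $ j"
  by (simp add: cscale_def)

lemma norm_cscale: "norm (c *\<^sub>c M) = norm c * norm M"
  by (simp add: norm_vec_def L2_set_def norm_mult power_mult_distrib sum_nonneg real_sqrt_mult
      flip: sum_distrib_left)

lemma bounded_linear_cscale: "bounded_linear (cscale c)"
  unfolding cscale_eq_mat_mult[abs_def] by (rule mm.bounded_linear_right)

lemma mat_power_commute: "A ** B = B ** A \<Longrightarrow> mat_power A n ** B = B ** mat_power A n"
  by (induction n) (simp_all, metis matrix_mul_assoc)

lemma mat_power_Suc2: "mat_power A (Suc n) = A ** mat_power A n"
  by (simp add: mat_power_commute)

lemma mat_power_cscale: "mat_power (c *\<^sub>c A) n = c ^ n *\<^sub>c mat_power A n"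
  by (induction n) (simp_all add: cscale_mult_left cscale_mult_right cscale_cscale mult.commute,
      simp add: cscale_eq_mat_mult)

section \<open>Polynomials in a matrix and annihilating products of shifts\<close>

definition mat_poly_eval :: "complex poly \<Rightarrow> complex^'n^'n \<Rightarrow> complex^'n^'n" where
  "mat_poly_eval p A = (\<Sum>i\<le>degree p. coeff p i *\<^sub>c mat_power A i)"

lemma mat_poly_eval_altdef:
  "degree p \<le> N \<Longrightarrow> mat_poly_eval p A = (\<Sum>i\<le>N. coeff p i *\<^sub>c mat_power A i)"
  unfolding mat_poly_eval_def
  by (rule sum.mono_neutral_left) (auto simp: coeff_eq_0 cscale_eq_mat_mult)

lemma mat_poly_eval_linear_factor:
  "mat_poly_eval ([:-x, 1:] * q) A = (A - mat x) ** mat_poly_eval q A"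
proof -
  let ?N = "Suc (degree q)"
  have deg: "degree ([:-x, 1:] * q) \<le> ?N"
    using degree_mult_le[of "[:-x, 1:]" q] by simp
  have coeff: "coeff ([:-x, 1:] * q) i = (- x) * coeff q i + coeff (pCons 0 q) i" for i by simp
  have "mat_poly_eval ([:-x, 1:] * q) A
      = (\<Sum>i\<le>?N. (- x) *\<^sub>c coeff q i *\<^sub>c mat_power A i) + (\<Sum>i\<le>?N. coeff (pCons 0 q) i *\<^sub>c mat_power A i)"
    unfolding mat_poly_eval_altdef[OF deg] coeff sum.distrib[symmetric]
    by (simp only: cscale_eq_mat_mult matrix_mul_assoc mat_add mat_mult mm.add_left)
  also have "(\<Sum>i\<le>?N. (- x) *\<^sub>c coeff q i *\<^sub>c mat_power A i) = (- x) *\<^sub>c mat_poly_eval q A"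
    by (simp add: mat_poly_eval_altdef[of q ?N] bounded_linear.linear[OF bounded_linear_cscale]
        linear_sum del: sum.atMost_Suc)
  also have "(\<Sum>i\<le>?N. coeff (pCons 0 q) i *\<^sub>c mat_power A i) = A ** mat_poly_eval q A"
    by (subst sum.atMost_Suc_shift)
      (simp add: mat_poly_eval_def mm.sum_right cscale_mult_right mat_power_Suc2 del: mat_power.simps,
        simp add: cscale_eq_mat_mult)
  finally show ?thesis
    by (simp add: mm.diff_left cscale_eq_mat_mult mat_minus mm.minus_left)
qed

text \<open>A list of more vectors than the dimension either repeats a vector or is a dependent set;
  the first case is separate because \<open>dependent\<close> speaks of sets.\<close>

lemma ex_linear_relation:
  fixes f :: "nat \<Rightarrow> 'a::euclidean_space"
  shows "\<exists>c N. (\<exists>i\<le>N. c i \<noteq> 0) \<and> (\<Sum>i\<le>N. c i *\<^sub>R f i) = 0"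
proof -
  let ?N = "DIM('a)"
  show ?thesis
  proof (cases "inj_on f {..?N}")
    case True
    then have "card (f ` {..?N}) = Suc ?N" by (simp add: card_image)
    then have "dependent (f ` {..?N})"
      by (intro dependent_biggerset) auto
    then obtain u v where u: "v \<in> f ` {..?N}" "u v \<noteq> 0" "(\<Sum>v\<in>f ` {..?N}. u v *\<^sub>R v) = 0"
      by (auto simp: dependent_finite)
    show ?thesis
      using u True by (intro exI[of _ "u \<circ> f"] exI[of _ ?N]) (auto simp: sum.reindex)
  next
    case False
    then obtain i j where ij: "i \<le> ?N" "j \<le> ?N" "i \<noteq> j" "f i = f j" by (auto simp: inj_on_def)
    have "(\<Sum>k\<le>?N. (if k = i then 1 else if k = j then -1 else 0) *\<^sub>R f k)
       = (\<Sum>k\<in>{i, j}. (if k = i then 1 else if k = j then -1 else 0) *\<^sub>R f k)"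
      using ij by (intro sum.mono_neutral_right) auto
    also have "\<dots> = 0" using ij by simp
    finally show ?thesis
      using ij by (intro exI[of _ "\<lambda>k. if k = i then 1 else if k = j then -1 else 0"] exI[of _ ?N]) auto
  qed
qed

primrec shift_prod :: "complex^'n^'n \<Rightarrow> complex list \<Rightarrow> complex^'n^'n" where
  "shift_prod P [] = mat 1"
| "shift_prod P (l # ls) = (P - mat l) ** shift_prod P ls"

lemma shift_prod_commute: "P ** shift_prod P ls = shift_prod P ls ** P"
proof (induction ls)
  case (Cons l ls)
  have "P ** (P - mat l) = (P - mat l) ** P"
    by (simp add: mm.diff_left mm.diff_right mat_mult_commute)
  then show ?case using Cons by simp (metis matrix_mul_assoc)
qed simp

lemma shift_prod_commute_shift:
  "(P - mat l) ** shift_prod P ls = shift_prod P ls ** (P - mat l)"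
  by (simp add: mm.diff_left mm.diff_right mat_mult_commute shift_prod_commute)

lemma matrix_mult_cancel_kernel:
  fixes M N :: "complex^'n^'n"
  assumes "\<And>v. M *v v = 0 \<Longrightarrow> v = 0" and "M ** N = 0"
  shows "N = 0"
proof -
  have "N *v v = 0" for v
    by (rule assms(1)) (simp add: matrix_vector_mul_assoc assms(2))
  then show ?thesis
    by (simp add: matrix_eq)
qed

text \<open>A factor P - l with Re l <= 0 is injective by positive stability and can be cancelled.
  \<open>X\<close> is arbitrary because the induction pushes the current factor past the others and
  into \<open>X\<close>.\<close>

lemma positive_stable_drop_factors:
  fixes P X :: "complex^'n^'n"
  assumes "positive_stable P"
  shows "shift_prod P ls ** X = 0 \<Longrightarrow> \<exists>ls'. (\<forall>l\<in>set ls'. Re l > 0) \<and> shift_prod P ls' ** X = 0"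
proof (induction ls arbitrary: X)
  case Nil
  then show ?case by (intro exI[of _ "[]"]) simp
next
  case (Cons l ls)
  have "shift_prod P ls ** ((P - mat l) ** X) = 0"
    using Cons.prems unfolding shift_prod.simps shift_prod_commute_shift matrix_mul_assoc .
  from Cons.IH[OF this] obtain ls' where ls': "\<forall>l\<in>set ls'. Re l > 0"
      and "shift_prod P ls' ** ((P - mat l) ** X) = 0"
    by blast
  then have *: "(P - mat l) ** (shift_prod P ls' ** X) = 0"
    by (simp only: shift_prod_commute_shift matrix_mul_assoc)
  show ?case
  proof (cases "Re l > 0")
    case True
    then show ?thesis using ls' * by (intro exI[of _ "l # ls'"]) (simp flip: matrix_mul_assoc)
  next
    case False
    have "v = 0" if "(P - mat l) *v v = 0" for v
    proof -
      have "mat l *v v = l *s v"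
        by (simp add: mat_def matrix_vector_mult_def vec_eq_iff mult_delta_left)
      with that have "P *v v = l *s v" by (simp add: matrix_vector_mult_diff_rdistrib)
      with assms False show ?thesis by (metis positive_stable_def)
    qed
    from matrix_mult_cancel_kernel[OF this *] show ?thesis using ls' by blast
  qed
qed

text \<open>The powers of \<open>P\<close> live in a finite-dimensional real space, so a nonzero
  polynomial with real coefficients annihilates \<open>P\<close>. It splits over the complex
  numbers, and its roots with nonpositive real part are then discarded by
  \<open>positive_stable_drop_factors\<close>.\<close>

lemma positive_stable_annihilator:
  fixes P :: "complex^'n^'n"
  assumes "positive_stable P"
  shows "\<exists>ls. (\<forall>l\<in>set ls. Re l > 0) \<and> shift_prod P ls = 0"
proof -
  obtain c N where c: "\<exists>i\<le>N. c i \<noteq> 0" "(\<Sum>i\<le>N. c i *\<^sub>R mat_power P i) = 0"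
    using ex_linear_relation by blast
  define p where "p = (\<Sum>i\<le>N. monom (complex_of_real (c i)) i)"
  have coeff: "coeff p i = (if i \<le> N then of_real (c i) else 0)" for i
    by (simp add: p_def coeff_sum)
  have p0: "p \<noteq> 0" using c(1) coeff by (metis coeff_0 of_real_eq_0_iff)
  have "degree p \<le> N" by (rule degree_le) (simp add: coeff)
  then have eval0: "mat_poly_eval p P = 0"
    using c(2) by (simp add: mat_poly_eval_altdef coeff cscale_of_real)
  obtain R where p: "p = smult (lead_coeff p) (\<Prod>x\<in>#R. [:-x, 1:])"
    using alg_closed_imp_factorization[OF p0] by blast
  obtain ls where R: "R = mset ls" by (metis ex_mset)
  have eval: "mat_poly_eval (smult k (\<Prod>x\<in>#mset ls. [:-x, 1:])) P = k *\<^sub>c shift_prod P ls" for k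
  proof (induction ls)
    case Nil
    then show ?case by (simp add: mat_poly_eval_def)
  next
    case (Cons l ls)
    have "smult k (\<Prod>x\<in>#mset (l # ls). [:-x, 1:]) = [:-l, 1:] * smult k (\<Prod>x\<in>#mset ls. [:-x, 1:])"
      by simp
    then show ?case using Cons
      by (simp only: mat_poly_eval_linear_factor shift_prod.simps cscale_mult_right)
  qed
  define k where "k = lead_coeff p"
  have "p = smult k (\<Prod>x\<in>#mset ls. [:-x, 1:])" using p unfolding k_def R .
  then have "mat_poly_eval p P = k *\<^sub>c shift_prod P ls"
    using eval by simp
  with eval0 have "k *\<^sub>c shift_prod P ls = 0" by simp
  moreover have "k \<noteq> 0" using p0 by (simp add: k_def)
  ultimately have "shift_prod P ls = 0"
    using norm_cscale[of k "shift_prod P ls"] by simp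
  then show ?thesis
    using positive_stable_drop_factors[OF assms, of ls "mat 1"] by simp
qed

text \<open>The operator acts on an arbitrary normed space because forms are wanted on matrices (for
  t^P) and on tensors (for 1F1). The lower bound on \<open>q\<close> is normalised to the constant
  1.\<close>

definition lyapunov_form ::
  "('v::real_normed_vector \<Rightarrow> 'v) \<Rightarrow> ('v \<Rightarrow> 'v \<Rightarrow> real) \<Rightarrow> real \<Rightarrow> bool" where
  "lyapunov_form T q d \<longleftrightarrow> bounded_bilinear q \<and> (\<forall>x y. q x y = q y x) \<and> d > 0
    \<and> (\<forall>x. (norm x)\<^sup>2 \<le> q x x) \<and> (\<forall>x. d * (norm x)\<^sup>2 \<le> q x (T x))"

lemma lyapunov_formD:
  assumes "lyapunov_form T q d"
  shows "bounded_bilinear q" "q x y = q y x" "d > 0" "(norm x)\<^sup>2 \<le> q x x" "d * (norm x)\<^sup>2 \<le> q x (T x)"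
  using assms by (auto simp: lyapunov_form_def)

text \<open>For a representation \<open>R\<close> of the matrix algebra, \<open>R (mat \<i>)\<close> is the complex structure
  of the underlying real inner product space.\<close>

locale matrix_rep =
  fixes R :: "complex^'n^'n \<Rightarrow> 'v::euclidean_space \<Rightarrow> 'v"
  assumes bilin: "bilinear R"
    and hom: "R (M ** N) x = R M (R N x)"
    and one: "R (mat 1) x = x"
    and skew: "x \<bullet> R (mat \<i>) x = 0"
begin

lemma mat_scalar: "R (mat l ** M) x = Re l *\<^sub>R R M x + Im l *\<^sub>R R (mat \<i>) (R M x)"
proof -
  have "mat l = Re l *\<^sub>R mat 1 + Im l *\<^sub>R (mat \<i> :: complex^'n^'n)"
    by (simp add: mat_def vec_eq_iff) (simp add: complex_eq_iff)
  then show ?thesis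
    using bilin by (simp add: hom bilinear_ladd bilinear_lmul one)
qed

text \<open>If \<open>W\<close> is the product of the shifts \<open>P - l\<close> seen so far, then
  \<open>W P = l W + W'\<close> with \<open>W' = (P - l) W\<close>; adding a large multiple of the square of \<open>R W x\<close> to
  the form moves the defect from \<open>W\<close> to \<open>W'\<close>.\<close>

lemma lyapunov_step:
  assumes "\<forall>l\<in>set ls. Re l > 0"
  shows "\<exists>q C d. bilinear q \<and> (\<forall>x y. q x y = q y x) \<and> d > 0 \<and> C > 0
    \<and> (\<forall>x. q x x \<ge> (norm x)\<^sup>2 - (norm (R (shift_prod P ls) x))\<^sup>2)
    \<and> (\<forall>x. q x x \<ge> 0)
    \<and> (\<forall>x. q x (R P x) \<ge> d * (norm x)\<^sup>2 - C * (norm (R (shift_prod P ls) x))\<^sup>2)"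
  using assms
proof (induction ls)
  case Nil
  \<comment> \<open>For the empty product the shift matrix is the identity, so q = 0 with C = d = 1
    works: the defect cancels |x|^2 exactly.\<close>
  show ?case
    by (intro exI[of _ "\<lambda>_ _. 0::real"] exI[of _ "1::real"]) (auto simp: bilinear_def linear_iff one)
next
  case (Cons l ls)
  then obtain q C d where q: "bilinear q" "\<And>x y. q x y = q y x" "d > 0" "C > (0::real)"
    "\<And>x. q x x \<ge> (norm x)\<^sup>2 - (norm (R (shift_prod P ls) x))\<^sup>2"
    "\<And>x. q x x \<ge> (0::real)"
    "\<And>x. q x (R P x) \<ge> d * (norm x)\<^sup>2 - C * (norm (R (shift_prod P ls) x))\<^sup>2"
    by auto
  define W where "W = shift_prod P ls"
  define W' where "W' = (P - mat l) ** W"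
  define r where "r = Re l"
  have r: "r > 0" using Cons.prems by (simp add: r_def)
  \<comment> \<open>M >= 2C/r lets M r / 2 absorb the old defect C |Wx|^2, and M >= 1 makes the new
    form dominate |x|^2.\<close>
  define M where "M = max 1 (2 * C / r)"
  have M: "M \<ge> 1" "M * r \<ge> 2 * C"
    using r by (auto simp: M_def max_def field_simps)
  define q' where "q' x y = q x y + M * (R W x \<bullet> R W y)" for x y
  have lin: "linear (R W)" using bilin by (simp add: bilinear_def)
  have a1: "bilinear q'"
    using q(1) lin unfolding bilinear_def q'_def
    by (auto simp: linear_iff algebra_simps)
  have a2: "q' x y = q' y x" for x y
    by (simp add: q'_def q(2)[of x y] inner_commute)
  have a3: "q' x x \<ge> (norm x)\<^sup>2" for x
  proof -
    have "M * (norm (R W x))\<^sup>2 \<ge> 1 * (norm (R W x))\<^sup>2" using M by (intro mult_right_mono) auto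
    then show ?thesis using q(5)[of x] by (simp add: q'_def W_def dot_square_norm)
  qed
  have a4: "q' x (R P x) \<ge> d * (norm x)\<^sup>2 - M / (2 * r) * (norm (R W' x))\<^sup>2" for x
  proof -
    have "W ** P = mat l ** W + W'"
      by (simp add: W'_def W_def mm.diff_left shift_prod_commute)
    then have "R W (R P x) = R (mat l ** W + W') x"
      by (metis hom)
    then have "R W (R P x) = r *\<^sub>R R W x + Im l *\<^sub>R R (mat \<i>) (R W x) + R W' x"
      by (simp only: bilinear_ladd[OF bilin] mat_scalar r_def)
    then have *: "R W x \<bullet> R W (R P x) = r * (norm (R W x))\<^sup>2 + R W x \<bullet> R W' x"
      by (simp add: inner_add_right skew dot_square_norm)
    \<comment> \<open>Young's inequality from a completed square: half of r |Wx|^2 is given up and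
      |W'x|^2 / (2r) remains, whence the new defect constant M / (2r).\<close>
    have "0 \<le> (norm (r *\<^sub>R R W x + R W' x))\<^sup>2" by simp
    also have "\<dots> = r\<^sup>2 * (norm (R W x))\<^sup>2 + 2 * r * (R W x \<bullet> R W' x) + (norm (R W' x))\<^sup>2"
      unfolding power2_norm_eq_inner inner_add_left inner_add_right inner_scaleR_left inner_scaleR_right
      by (simp add: inner_commute[of "R W' x" "R W x"] algebra_simps power2_eq_square)
    finally have "R W x \<bullet> R W' x \<ge> - (r / 2) * (norm (R W x))\<^sup>2 - (norm (R W' x))\<^sup>2 / (2 * r)"
      using r by (simp add: field_simps power2_eq_square)
    with * have "R W x \<bullet> R W (R P x) \<ge> r / 2 * (norm (R W x))\<^sup>2 - (norm (R W' x))\<^sup>2 / (2 * r)"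
      by simp
    from mult_left_mono[OF this, of M] M
    have "M * (R W x \<bullet> R W (R P x)) \<ge> M * r / 2 * (norm (R W x))\<^sup>2 - M / (2 * r) * (norm (R W' x))\<^sup>2"
      by (simp add: right_diff_distrib)
    moreover have "M * r / 2 * (norm (R W x))\<^sup>2 \<ge> C * (norm (R W x))\<^sup>2"
      using M by (intro mult_right_mono) auto
    ultimately show ?thesis using q(7)[of x] by (simp add: q'_def W_def)
  qed
  have W': "shift_prod P (l # ls) = W'" by (simp add: W'_def W_def)
  have a5: "M / (2 * r) > 0" using M r by simp
  have a6: "q' x x \<ge> 0" for x
    using q(6)[of x] M(1) by (simp add: q'_def)
  have a7: "q' x x \<ge> (norm x)\<^sup>2 - (norm (R W' x))\<^sup>2" for x
    using a3[of x] zero_le_power2[of "norm (R W' x)"] by linarith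
  show ?case
    unfolding W' by (intro exI[of _ q'] exI[of _ "M / (2 * r)"] exI[of _ d] conjI allI a1 a2 q(3) a5 a7 a6 a4)
qed

text \<open>Once the product of shifts is 0, the defect terms of \<open>lyapunov_step\<close>
  vanish.\<close>

lemma ex_lyapunov_form:
  assumes "positive_stable P"
  shows "\<exists>q d. lyapunov_form (R P) q d"
proof -
  obtain ls where ls: "\<forall>l\<in>set ls. Re l > 0" "shift_prod P ls = 0"
    using positive_stable_annihilator[OF assms] by blast
  have "R 0 x = 0" for x using bilin by (rule bilinear_lzero)
  then show ?thesis
    using lyapunov_step[OF ls(1), of P, unfolded ls(2)]
    unfolding lyapunov_form_def bilinear_conv_bounded_bilinear[symmetric]
    by (elim exE conjE, intro exI conjI) (assumption | simp)+
qed

end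

section \<open>Matrix exponential and matrix powers\<close>

text \<open>A ratio test with the weight K^n built in: l = 0 gives every radius (exponential, 1F1),
  and l = |z| reaches the endpoint K = 1 for the binomial series.\<close>

lemma summable_ratio_limit:
  fixes u :: "nat \<Rightarrow> 'a::real_normed_vector"
  assumes ratio: "\<forall>\<^sub>F n in sequentially. norm (u (Suc n)) \<le> r n * norm (u n)"
    and lim: "r \<longlonglongrightarrow> l" and "l * K < 1" and K: "K \<ge> 0"
  shows "summable (\<lambda>n. norm (u n) * K ^ n)"
proof -
  obtain c where c: "l * K < c" "c < 1" using dense[OF assms(3)] by blast
  have "(\<lambda>n. r n * K) \<longlonglongrightarrow> l * K" by (intro tendsto_intros lim)
  from order_tendstoD(2)[OF this c(1)] ratio
  have "\<forall>\<^sub>F n in sequentially. norm (norm (u (Suc n)) * K ^ Suc n) \<le> c * norm (norm (u n) * K ^ n)"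
  proof eventually_elim
    case (elim n)
    have "norm (u (Suc n)) * K ^ Suc n \<le> (r n * norm (u n)) * K ^ Suc n"
      using elim(2) K by (intro mult_right_mono) auto
    also have "\<dots> = (r n * K) * (norm (u n) * K ^ n)" by simp
    also have "\<dots> \<le> c * (norm (u n) * K ^ n)"
      using elim(1) K by (intro mult_right_mono) auto
    finally show ?case using K by simp
  qed
  then obtain N where "\<forall>n\<ge>N. norm (norm (u (Suc n)) * K ^ Suc n) \<le> c * norm (norm (u n) * K ^ n)"
    unfolding eventually_sequentially by blast
  with c(2) show ?thesis by (intro summable_ratio_test[of c N]) blast+
qed

lemma powser_termdiff_norm_summable:
  fixes u :: "nat \<Rightarrow> 'a::real_normed_vector"
  assumes conv: "\<And>s. 0 \<le> s \<Longrightarrow> s < K \<Longrightarrow> summable (\<lambda>n. norm (u n) * s ^ n)"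
    and "0 \<le> s" "s < K"
  shows "summable (\<lambda>n. norm (real (Suc n) *\<^sub>R u (Suc n)) * s ^ n)"
proof -
  have "summable (\<lambda>n. diffs (\<lambda>n. norm (u n)) n * s ^ n)"
  proof (rule termdiff_converges[where K = K])
    show "norm s < K" using assms by simp
    fix x :: real assume x: "norm x < K"
    show "summable (\<lambda>n. norm (u n) * x ^ n)"
      by (rule summable_norm_cancel) (use conv[of "\<bar>x\<bar>"] x in \<open>simp add: abs_mult power_abs\<close>)
  qed
  then show ?thesis by (simp add: diffs_def del: of_nat_Suc)
qed

lemma powser_summable:
  fixes u :: "nat \<Rightarrow> 'a::banach"
  assumes "\<And>s. 0 \<le> s \<Longrightarrow> s < K \<Longrightarrow> summable (\<lambda>n. norm (u n) * s ^ n)" and "\<bar>s\<bar> < K"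
  shows "summable (\<lambda>n. s ^ n *\<^sub>R u n)"
proof (rule summable_norm_cancel)
  have "norm (s ^ n *\<^sub>R u n) = norm (u n) * \<bar>s\<bar> ^ n" for n
    by (simp add: power_abs)
  then show "summable (\<lambda>n. norm (s ^ n *\<^sub>R u n))"
    using assms(1)[OF abs_ge_zero assms(2)] by (simp only:)
qed

text \<open>Inner products with basis vectors reduce the claim to termwise differentiation of real
  power series.\<close>

lemma powser_has_vector_derivative:
  fixes u :: "nat \<Rightarrow> 'a::euclidean_space"
  assumes conv: "\<And>s. 0 \<le> s \<Longrightarrow> s < K \<Longrightarrow> summable (\<lambda>n. norm (u n) * s ^ n)"
    and s: "\<bar>s\<bar> < K"
  shows "((\<lambda>s. \<Sum>n. s ^ n *\<^sub>R u n) has_vector_derivative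
    (\<Sum>n. s ^ n *\<^sub>R (real (Suc n) *\<^sub>R u (Suc n)))) (at s)"
  unfolding has_vector_derivative_def
proof (subst has_derivative_componentwise_within, rule ballI)
  fix b :: 'a
  let ?u' = "\<lambda>n. real (Suc n) *\<^sub>R u (Suc n)"
  have smu: "summable (\<lambda>n. x ^ n *\<^sub>R u n)" if "\<bar>x\<bar> < K" for x
    using conv that by (rule powser_summable)
  have smu': "summable (\<lambda>n. s ^ n *\<^sub>R ?u' n)"
    using powser_termdiff_norm_summable[OF conv] s by (rule powser_summable)
  have inner: "(\<Sum>n. x ^ n *\<^sub>R u n) \<bullet> b = (\<Sum>n. (u n \<bullet> b) * x ^ n)" if "\<bar>x\<bar> < K" for x
    using bounded_linear.suminf[OF bounded_linear_inner_left smu[OF that], of b]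
    by (simp add: mult.commute)
  have inner': "(\<Sum>n. s ^ n *\<^sub>R ?u' n) \<bullet> b = (\<Sum>n. diffs (\<lambda>n. u n \<bullet> b) n * s ^ n)"
    using bounded_linear.suminf[OF bounded_linear_inner_left smu', of b]
    by (simp add: diffs_def mult_ac)
  have "((\<lambda>x. \<Sum>n. (u n \<bullet> b) * x ^ n) has_field_derivative
      (\<Sum>n. diffs (\<lambda>n. u n \<bullet> b) n * s ^ n)) (at s)"
  proof (rule termdiffs_strong')
    fix x :: real assume "norm x < K"
    then show "summable (\<lambda>n. (u n \<bullet> b) * x ^ n)"
      using bounded_linear.summable[OF bounded_linear_inner_left smu, of x b]
      by (simp add: mult.commute)
  qed (use s in simp)
  then have "((\<lambda>x. (\<Sum>n. x ^ n *\<^sub>R u n) \<bullet> b) has_field_derivative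
      (\<Sum>n. diffs (\<lambda>n. u n \<bullet> b) n * s ^ n)) (at s)"
    by (rule has_field_derivative_transform_within_open[where S = "{-K<..<K}"])
      (use s inner in auto)
  then show "((\<lambda>x. (\<Sum>n. x ^ n *\<^sub>R u n) \<bullet> b) has_derivative
      (\<lambda>x. (x *\<^sub>R (\<Sum>n. s ^ n *\<^sub>R ?u' n)) \<bullet> b)) (at s)"
    unfolding has_field_derivative_def inner_scaleR_left inner' mult_commute_abs .
qed

lemma matrix_mult_norm_bound:
  obtains C where "C > 0" "\<And>(A :: complex^'n^'n) (B :: complex^'n^'n). norm (A ** B) \<le> C * norm A * norm B"
proof -
  obtain C where C: "C > 0 \<and> (\<forall>(A :: complex^'n^'n) (B :: complex^'n^'n). norm (A ** B) \<le> norm A * norm B * C)"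
    using mm.pos_bounded ..
  show ?thesis
    by (rule that[of C]) (use C in \<open>simp_all add: mult_ac\<close>)
qed

section \<open>The matrix exponential\<close>

lemma mat_exp_series_summable:
  "summable (\<lambda>n. norm (mat_power A n /\<^sub>R fact n :: complex^'n^'n) * K ^ n)" if "K \<ge> 0"
proof -
  obtain C where C: "C > 0" "\<And>(A :: complex^'n^'n) (B :: complex^'n^'n). norm (A ** B) \<le> C * norm A * norm B"
    by (rule matrix_mult_norm_bound) blast
  have "(\<lambda>n. norm A * C / real (Suc n)) \<longlonglongrightarrow> 0"
    using LIMSEQ_Suc[OF lim_const_over_n[of "norm A * C"]] by simp
  moreover have "norm (mat_power A (Suc n) /\<^sub>R fact (Suc n))
    \<le> norm A * C / real (Suc n) * norm (mat_power A n /\<^sub>R fact n)" for n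
  proof -
    have "norm (mat_power A (Suc n) /\<^sub>R fact (Suc n)) = norm (mat_power A n ** A) / fact (Suc n)"
      by (simp add: divide_inverse del: fact_Suc)
    also have "\<dots> \<le> (C * norm (mat_power A n) * norm A) / fact (Suc n)"
      by (intro divide_right_mono C) simp
    also have "\<dots> = norm A * C / real (Suc n) * norm (mat_power A n /\<^sub>R fact n)"
      by (simp add: field_simps)
    finally show ?thesis .
  qed
  ultimately show ?thesis
    using that by (intro summable_ratio_limit[where l = 0]) auto
qed

lemma mat_exp_summable: "summable (\<lambda>n. mat_power A n /\<^sub>R fact n)"
  by (rule summable_norm_cancel) (use mat_exp_series_summable[of 1 A] in simp)

lemma mat_exp_scaleR: "mat_exp (t *\<^sub>R A) = (\<Sum>n. t ^ n *\<^sub>R (mat_power A n /\<^sub>R fact n))"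
proof -
  have "mat_power (t *\<^sub>R A) n = t ^ n *\<^sub>R mat_power A n" for n
    using mat_power_cscale[of "of_real t" A n] unfolding of_real_power[symmetric] cscale_of_real .
  then show ?thesis
    unfolding mat_exp_def by (simp add: mult.commute)
qed

lemma mat_exp_commute:
  fixes A B :: "complex^'n^'n"
  assumes "A ** B = B ** A"
  shows "mat_exp A ** B = B ** mat_exp A"
proof -
  have "mat_exp A ** B = (\<Sum>n. (mat_power A n /\<^sub>R fact n) ** B)"
    unfolding mat_exp_def by (rule bounded_linear.suminf[OF mm.bounded_linear_left mat_exp_summable])
  also have "\<dots> = (\<Sum>n. B ** (mat_power A n /\<^sub>R fact n))"
    by (simp add: mm.scaleR_left mm.scaleR_right mat_power_commute[OF assms])
  also have "\<dots> = B ** mat_exp A"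
    unfolding mat_exp_def
    by (rule bounded_linear.suminf[OF mm.bounded_linear_right mat_exp_summable, symmetric])
  finally show ?thesis .
qed

lemma mat_exp_has_vector_derivative:
  fixes A :: "complex^'n^'n"
  shows "((\<lambda>t. mat_exp (t *\<^sub>R A)) has_vector_derivative A ** mat_exp (t *\<^sub>R A)) (at t)"
proof -
  let ?u = "\<lambda>n. mat_power A n /\<^sub>R fact n"
  have conv: "summable (\<lambda>n. norm (?u n) * s ^ n)" if "0 \<le> s" for s
    using mat_exp_series_summable[OF that] .
  have "((\<lambda>t. mat_exp (t *\<^sub>R A)) has_vector_derivative
      (\<Sum>n. t ^ n *\<^sub>R (real (Suc n) *\<^sub>R ?u (Suc n)))) (at t)"
    unfolding mat_exp_scaleR
    by (rule powser_has_vector_derivative[where K = "\<bar>t\<bar> + 1"]) (use conv in auto)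
  also have "(\<lambda>n. t ^ n *\<^sub>R (real (Suc n) *\<^sub>R ?u (Suc n))) = (\<lambda>n. A ** (t ^ n *\<^sub>R ?u n))"
    by (simp add: mm.scaleR_right mat_power_commute fun_eq_iff)
  also have "(\<Sum>n. A ** (t ^ n *\<^sub>R ?u n)) = A ** mat_exp (t *\<^sub>R A)"
    unfolding mat_exp_scaleR
    by (rule bounded_linear.suminf[OF mm.bounded_linear_right, symmetric],
        rule powser_summable[where K = "\<bar>t\<bar> + 1"]) (use conv in auto)
  finally show ?thesis .
qed

lemma mat_exp_0 [simp]: "mat_exp 0 = mat 1"
proof -
  have "mat_exp (0 :: complex^'n^'n) = (\<Sum>n. if n = 0 then mat 1 else 0)"
    unfolding mat_exp_def
  proof (rule suminf_cong)
    fix n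
    show "mat_power (0 :: complex^'n^'n) n /\<^sub>R fact n = (if n = 0 then mat 1 else 0)"
      by (cases n) auto
  qed
  also have "\<dots> = mat 1" by (subst suminf_finite[of "{0}"]) auto
  finally show ?thesis .
qed

lemma vector_derivative_zero_imp_eq:
  fixes f :: "real \<Rightarrow> 'a::real_normed_vector"
  assumes "convex S" "\<And>t. t \<in> S \<Longrightarrow> (f has_vector_derivative 0) (at t)" "x \<in> S" "y \<in> S"
  shows "f x = f y"
  using has_vector_derivative_zero_constant[OF assms(1), of f] assms(2-4)
  by (metis has_vector_derivative_at_within)

text \<open>Here and in \<open>mat_exp_add\<close> a product of exponentials along real t has
  derivative 0 and equals the identity at t = 0. This case comes first because it supplies the
  inverse by which \<open>mat_exp_add\<close> cancels its third factor.\<close>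

lemma mat_exp_minus: "mat_exp A ** mat_exp (- A) = mat 1"
proof -
  let ?D = "\<lambda>t. mat_exp (t *\<^sub>R A) ** mat_exp (t *\<^sub>R (- A))"
  have "?D 1 = ?D 0"
  proof (rule vector_derivative_zero_imp_eq[where S = UNIV])
    fix t :: real
    have c: "mat_exp (t *\<^sub>R A) ** A = A ** mat_exp (t *\<^sub>R A)"
      by (rule mat_exp_commute) (simp add: mm.scaleR_left mm.scaleR_right)
    have "mat_exp (t *\<^sub>R A) ** ((- A) ** mat_exp (t *\<^sub>R (- A)))
        + (A ** mat_exp (t *\<^sub>R A)) ** mat_exp (t *\<^sub>R (- A)) = 0"
      by (simp add: mm.minus_left mm.minus_right matrix_mul_assoc c)
    with mm.has_vector_derivative[OF mat_exp_has_vector_derivative[of A t]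
        mat_exp_has_vector_derivative[of "- A" t]]
    show "(?D has_vector_derivative 0) (at t)" by simp
  qed auto
  then show ?thesis by simp
qed

lemma mat_exp_add:
  fixes A B :: "complex^'n^'n"
  assumes AB: "A ** B = B ** A"
  shows "mat_exp (A + B) = mat_exp A ** mat_exp B"
proof -
  let ?C = "- (A + B)"
  let ?D = "\<lambda>t. (mat_exp (t *\<^sub>R A) ** mat_exp (t *\<^sub>R B)) ** mat_exp (t *\<^sub>R ?C)"
  have "?D 1 = ?D 0"
  proof (rule vector_derivative_zero_imp_eq[where S = UNIV])
    fix t :: real
    let ?a = "mat_exp (t *\<^sub>R A)" and ?b = "mat_exp (t *\<^sub>R B)" and ?c = "mat_exp (t *\<^sub>R ?C)"
    have aB: "?a ** B = B ** ?a"
      by (rule mat_exp_commute) (simp add: mm.scaleR_left mm.scaleR_right AB)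
    have aA: "?a ** A = A ** ?a" by (rule mat_exp_commute) (simp add: mm.scaleR_left mm.scaleR_right)
    have bA: "?b ** A = A ** ?b"
      by (rule mat_exp_commute) (simp add: mm.scaleR_left mm.scaleR_right AB)
    have bB: "?b ** B = B ** ?b" by (rule mat_exp_commute) (simp add: mm.scaleR_left mm.scaleR_right)
    have "(?a ** ?b) ** (A + B) = (A + B) ** (?a ** ?b)"
      by (simp add: mm.add_left mm.add_right) (metis aA aB bA bB matrix_mul_assoc)
    moreover have "?a ** (B ** ?b) + (A ** ?a) ** ?b = (A + B) ** (?a ** ?b)"
      by (simp add: mm.add_left) (metis aB add.commute matrix_mul_assoc)
    ultimately have "(?a ** ?b) ** (?C ** ?c) + (?a ** (B ** ?b) + (A ** ?a) ** ?b) ** ?c = 0"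
      by (metis (no_types, lifting) ab_left_minus matrix_mul_assoc mm.minus_left mm.minus_right)
    with mm.has_vector_derivative[OF mm.has_vector_derivative[OF mat_exp_has_vector_derivative[of A t]
          mat_exp_has_vector_derivative[of B t]] mat_exp_has_vector_derivative[of ?C t]]
    show "(?D has_vector_derivative 0) (at t)" by simp
  qed auto
  then have "(mat_exp A ** mat_exp B) ** mat_exp ?C = mat 1" by simp
  then have "mat_exp A ** mat_exp B ** (mat_exp ?C ** mat_exp (A + B)) = mat_exp (A + B)"
    by (simp add: matrix_mul_assoc)
  then show ?thesis using mat_exp_minus[of ?C] by (simp only: minus_minus matrix_mul_rid)
qed

lemma mat_exp_mat: "mat_exp (mat c) = (mat (exp c) :: complex^'n^'n)"
proof -
  have "bounded_linear (mat :: complex \<Rightarrow> complex^'n^'n)"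
    by (intro linear_conv_bounded_linear[THEN iffD1] linearI) (simp_all add: mat_def vec_eq_iff)
  from bounded_linear.suminf[OF this summable_exp_generic[of c]]
  have "mat (exp c) = (\<Sum>n. mat (c ^ n /\<^sub>R fact n) :: complex^'n^'n)" by (simp add: exp_def)
  also have "\<dots> = mat_exp (mat c)"
    unfolding mat_exp_def
  proof (rule suminf_cong)
    fix n
    have "mat_power (mat c :: complex^'n^'n) n = mat (c ^ n)"
      by (induction n) (simp_all add: mat_mult[symmetric] mult.commute)
    then show "(mat (c ^ n /\<^sub>R fact n) :: complex^'n^'n) = mat_power (mat c) n /\<^sub>R fact n"
      by (simp add: mat_def vec_eq_iff)
  qed
  finally show ?thesis ..
qed

text \<open>The derivative known so far concerns real multiples of a fixed matrix. So a complex
  multiple x A is split as Re x A + Im x (iA), a sum of commuting matrices with real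
  coefficients.\<close>

lemma mat_exp_curve_has_vector_derivative:
  fixes A :: "complex^'n^'n" and c :: "real \<Rightarrow> complex"
  assumes "(c has_vector_derivative c') (at t)"
  shows "((\<lambda>t. mat_exp (c t *\<^sub>c A)) has_vector_derivative (c' *\<^sub>c A) ** mat_exp (c t *\<^sub>c A)) (at t)"
proof -
  let ?B = "\<i> *\<^sub>c A"
  have split: "x *\<^sub>c A = Re x *\<^sub>R A + Im x *\<^sub>R ?B" for x
    by (simp add: vec_eq_iff complex_eq_iff)
  have comm: "A ** ?B = ?B ** A" by (simp add: cscale_mult_left cscale_mult_right)
  have eq: "mat_exp (x *\<^sub>c A) = mat_exp (Re x *\<^sub>R A) ** mat_exp (Im x *\<^sub>R ?B)" for x
    unfolding split[of x] by (rule mat_exp_add) (simp only: mm.scaleR_left mm.scaleR_right comm scaleR_scaleR mult.commute)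
  have re: "((\<lambda>t. mat_exp (Re (c t) *\<^sub>R A)) has_vector_derivative
      Re c' *\<^sub>R (A ** mat_exp (Re (c t) *\<^sub>R A))) (at t)"
    using vector_diff_chain_at[OF bounded_linear.has_vector_derivative[OF bounded_linear_Re assms]
        mat_exp_has_vector_derivative] by (simp add: o_def)
  have im: "((\<lambda>t. mat_exp (Im (c t) *\<^sub>R ?B)) has_vector_derivative
      Im c' *\<^sub>R (?B ** mat_exp (Im (c t) *\<^sub>R ?B))) (at t)"
    using vector_diff_chain_at[OF bounded_linear.has_vector_derivative[OF bounded_linear_Im assms]
        mat_exp_has_vector_derivative] by (simp add: o_def)
  have "mat_exp (Re (c t) *\<^sub>R A) ** ?B = ?B ** mat_exp (Re (c t) *\<^sub>R A)"
    by (rule mat_exp_commute) (simp add: mm.scaleR_left mm.scaleR_right comm)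
  then have "mat_exp (Re (c t) *\<^sub>R A) ** (Im c' *\<^sub>R (?B ** mat_exp (Im (c t) *\<^sub>R ?B)))
      + (Re c' *\<^sub>R (A ** mat_exp (Re (c t) *\<^sub>R A))) ** mat_exp (Im (c t) *\<^sub>R ?B)
    = (c' *\<^sub>c A) ** mat_exp (c t *\<^sub>c A)"
    unfolding eq split[of c'] by (simp add: mm.scaleR_left mm.scaleR_right mm.add_left matrix_mul_assoc)
  with mm.has_vector_derivative[OF re im] show ?thesis unfolding eq by simp
qed

section \<open>Matrix powers with the principal logarithm\<close>

lemma cpow_mat_has_vector_derivative:
  fixes A :: "complex^'n^'n" and c :: "real \<Rightarrow> complex"
  assumes "(c has_vector_derivative c') (at t)" and "c t \<notin> \<real>\<^sub>\<le>\<^sub>0"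
  shows "((\<lambda>t. cpow_mat (c t) A) has_vector_derivative
    ((c' / c t) *\<^sub>c A) ** cpow_mat (c t) A) (at t)"
  unfolding cpow_mat_def
  using mat_exp_curve_has_vector_derivative[OF field_vector_diff_chain_at[OF assms(1)
        has_field_derivative_Ln[OF assms(2)]], of A]
  by (simp add: o_def divide_inverse)

lemma cpow_mat_add:
  assumes "A ** B = B ** A"
  shows "cpow_mat s (A + B) = cpow_mat s A ** cpow_mat s B"
  unfolding cpow_mat_def using assms
  by (subst mat_exp_add[symmetric])
    (simp_all add: cscale_mult_left cscale_mult_right cscale_cscale mult.commute,
      simp add: cscale_eq_mat_mult mm.add_right)

lemma cpow_mat_minus: "cpow_mat s A ** cpow_mat s (- A) = mat 1"
  unfolding cpow_mat_def using mat_exp_minus[of "Ln s *\<^sub>c A"]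
  by (simp add: cscale_eq_mat_mult mm.minus_right)

text \<open>A positive real factor leaves the argument of \<open>s\<close> unchanged, so the
  principal logarithm is additive here, which fails for general complex factors.\<close>

lemma cpow_mat_mult_of_real:
  assumes "r > 0" "s \<noteq> 0"
  shows "cpow_mat (of_real r * s) A = cpow_mat s A ** cpow_mat (of_real r) A"
proof -
  have "Ln (of_real r * s) = Ln s + Ln (of_real r)"
    using Ln_times_of_real[OF assms] assms by (simp add: Ln_of_real)
  then show ?thesis unfolding cpow_mat_def
    by (subst mat_exp_add[symmetric])
      (simp_all add: cscale_mult_left cscale_mult_right cscale_cscale mult.commute,
        simp add: cscale_eq_mat_mult mm.add_left mat_add)
qed

lemma cpow_mat_inverse_of_real:
  assumes "r > 0"
  shows "cpow_mat (inverse (of_real r)) A = cpow_mat (of_real r) (- A)"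
proof -
  have "Ln (inverse (of_real r)) = - Ln (of_real r)"
    using assms by (intro Ln_inverse) auto
  moreover have "- Ln (of_real r) *\<^sub>c A = Ln (of_real r) *\<^sub>c - A"
    by (simp add: vec_eq_iff)
  ultimately show ?thesis by (simp add: cpow_mat_def)
qed

lemma cpow_mat_mat: "s \<noteq> 0 \<Longrightarrow> cpow_mat s (mat (of_nat n)) = mat (s ^ n)"
  by (simp add: cpow_mat_def cscale_eq_mat_mult mat_mult[symmetric] mat_exp_mat
      exp_of_nat_mult mult.commute[of "Ln s"])

lemma cpow_mat_add_of_nat:
  "s \<noteq> 0 \<Longrightarrow> cpow_mat s (A + mat (of_nat n)) = s ^ n *\<^sub>c cpow_mat s A"
  by (simp add: cpow_mat_add[OF mat_mult_commute] cpow_mat_mat mat_mult_commute cscale_eq_mat_mult)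

lemma cpow_mat_1: "cpow_mat 1 A = mat 1"
  by (simp add: cpow_mat_def cscale_eq_mat_mult)

lemma cpow_mat_commute:
  "A ** B = B ** A \<Longrightarrow> cpow_mat s A ** B = B ** cpow_mat s A"
  unfolding cpow_mat_def
  by (rule mat_exp_commute) (simp add: cscale_mult_left cscale_mult_right)

lemma inner_mat_imaginary: "X \<bullet> (mat \<i> ** X) = 0" for X :: "complex^'n^'n"
  by (simp flip: cscale_eq_mat_mult add: inner_vec_def inner_complex_def)

text \<open>With matrices themselves as the represented space, t^P is a moving point at which a form
  can be evaluated.\<close>

interpretation left_mult: matrix_rep "(**) :: complex^'n^'n \<Rightarrow> complex^'n^'n \<Rightarrow> complex^'n^'n"
  by standard (simp_all add: bilinear_conv_bounded_bilinear bounded_bilinear_matrix_mult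
      matrix_mul_assoc inner_mat_imaginary)

text \<open>The curve phi(t) = t^P solves t phi' = P phi, so q(phi, phi) grows at least like t^(2e).
  Hence \<open>E\<close> is nondecreasing, and E(t) <= E(1) bounds |t^P| by a multiple of
  t^e.\<close>

lemma positive_stable_cpow_bound:
  fixes P :: "complex^'n^'n"
  assumes "positive_stable P"
  obtains C d where "C \<ge> 0" "d > 0"
    "\<And>t::real. 0 < t \<Longrightarrow> t \<le> 1 \<Longrightarrow> norm (cpow_mat (of_real t) (P - mat 1)) \<le> C * t powr (d - 1)"
proof -
  obtain q d where "lyapunov_form ((**) P :: complex^'n^'n \<Rightarrow> complex^'n^'n) q d"
    using left_mult.ex_lyapunov_form[OF assms] by blast
  note q = lyapunov_formD[OF this]
  obtain K where K: "K > 0" "\<And>x y. norm (q x y) \<le> norm x * norm y * K"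
    using bounded_bilinear.pos_bounded[OF q(1)] by auto
  have qK: "q x x \<le> K * (norm x)\<^sup>2" for x
    using K(2)[of x x] by (simp add: power2_eq_square algebra_simps)
  \<comment> \<open>The growth rate has to be measured against q instead of the norm: q(x, Px) >= d
    |x|^2 >= (d/K) q(x, x).\<close>
  define e where "e = d / K"
  have e: "e > 0" using q(3) K(1) by (simp add: e_def)
  define \<phi> where "\<phi> t = cpow_mat (complex_of_real t) P" for t
  define E where "E t = t powr (-2 * e) * q (\<phi> t) (\<phi> t)" for t
  have E: "E t \<le> E 1" if t: "0 < t" "t \<le> 1" for t
  proof (rule DERIV_nonneg_imp_nondecreasing[OF t(2)])
    fix s assume "t \<le> s" "s \<le> 1"
    with t have s: "s > 0" by simp
    have "((\<lambda>x. complex_of_real x) has_vector_derivative 1) (at s)"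
      using bounded_linear.has_vector_derivative[OF bounded_linear_of_real has_vector_derivative_id]
      by simp
    from cpow_mat_has_vector_derivative[OF this, of P] s
    have "(\<phi> has_vector_derivative ((1 / complex_of_real s) *\<^sub>c P) ** \<phi> s) (at s)"
      unfolding \<phi>_def by simp
    moreover have "((1 / complex_of_real s) *\<^sub>c P) ** \<phi> s = (1 / s) *\<^sub>R (P ** \<phi> s)"
      using cscale_of_real[of "1 / s" P] by (simp add: mm.scaleR_left)
    ultimately have "(\<phi> has_vector_derivative (1 / s) *\<^sub>R (P ** \<phi> s)) (at s)" by simp
    from bounded_bilinear.has_vector_derivative[OF q(1) this this]
    have dq: "((\<lambda>s. q (\<phi> s) (\<phi> s)) has_real_derivative 2 / s * q (\<phi> s) (P ** \<phi> s)) (at s)"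
      unfolding has_real_derivative_iff_has_vector_derivative
      by (simp add: bounded_bilinear.scaleR_left[OF q(1)] bounded_bilinear.scaleR_right[OF q(1)]
          q(2)[of "P ** \<phi> s"])
    have dp: "((\<lambda>s. s powr (-2 * e)) has_real_derivative (-2 * e) * s powr (-2 * e - 1)) (at s)"
      using s by (rule has_real_derivative_powr)
    have "(E has_real_derivative (-2 * e) * s powr (-2 * e - 1) * q (\<phi> s) (\<phi> s)
        + 2 / s * q (\<phi> s) (P ** \<phi> s) * s powr (-2 * e)) (at s)"
      unfolding E_def by (rule DERIV_mult[OF dp dq])
    moreover have "s powr (-2 * e - 1) = s powr (-2 * e) / s"
      using s by (simp add: powr_diff)
    moreover have "e * q (\<phi> s) (\<phi> s) \<le> q (\<phi> s) (P ** \<phi> s)"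
    proof -
      have "e * q (\<phi> s) (\<phi> s) \<le> e * (K * (norm (\<phi> s))\<^sup>2)"
        using e qK by (intro mult_left_mono) auto
      also have "\<dots> = d * (norm (\<phi> s))\<^sup>2" using K(1) by (simp add: e_def)
      finally show ?thesis using q(5)[of "\<phi> s"] by simp
    qed
    then have "2 / s * s powr (-2 * e) * (q (\<phi> s) (P ** \<phi> s) - e * q (\<phi> s) (\<phi> s)) \<ge> 0"
      using s by (intro mult_nonneg_nonneg) auto
    ultimately show "\<exists>y. (E has_real_derivative y) (at s) \<and> 0 \<le> y"
      by (intro exI conjI) (assumption, simp add: algebra_simps)
  qed
  have E1: "E 1 \<ge> 0"
    using q(4)[of "\<phi> 1"] by (simp add: E_def) (meson order_trans zero_le_power2)
  show thesis
  proof (rule that[of "sqrt (E 1)" e])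
    fix t :: real assume t: "0 < t" "t \<le> 1"
    have "(norm (\<phi> t))\<^sup>2 \<le> q (\<phi> t) (\<phi> t)" by (rule q(4))
    also have "\<dots> = t powr (2 * e) * E t"
      using t by (simp add: E_def mult.assoc[symmetric] powr_add[symmetric])
    also have "\<dots> \<le> t powr (2 * e) * E 1" by (intro mult_left_mono E t) simp
    also have "\<dots> = (sqrt (E 1) * t powr e)\<^sup>2"
      using E1 by (simp add: power_mult_distrib power2_eq_square[of "t powr e"] flip: powr_add)
    finally have \<phi>: "norm (\<phi> t) \<le> sqrt (E 1) * t powr e"
      by (rule power2_le_imp_le) (use E1 in auto)
    have "cpow_mat (of_real t) P = t *\<^sub>R cpow_mat (of_real t) (P - mat 1)"
      using t cpow_mat_add_of_nat[of "of_real t" "P - mat 1" 1] by (simp add: cscale_of_real)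
    then have "norm (cpow_mat (of_real t) (P - mat 1)) = norm (\<phi> t) / t"
      using t by (simp add: \<phi>_def)
    also have "\<dots> \<le> sqrt (E 1) * t powr (e - 1)"
      using \<phi> t by (simp add: powr_diff divide_right_mono)
    finally show "norm (cpow_mat (of_real t) (P - mat 1)) \<le> sqrt (E 1) * t powr (e - 1)" .
  qed (use E1 e in auto)
qed

section \<open>Boundedness of hypergeometric series\<close>

text \<open>For large \<open>s\<close> the \<open>v\<close>-component is damped at rate \<open>S\<close> and the \<open>w\<close>-component at rate \<open>T / s\<close>,
  which dominates the coupling terms of order \<open>1 / s\<close>; so the energy \<open>p w w + q v v\<close> decreases.\<close>

lemma damped_system_bounded:
  fixes w v :: "real \<Rightarrow> 'v::euclidean_space"
  assumes T: "lyapunov_form T p a" and S: "lyapunov_form S q b"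
    and linT: "bounded_linear T" and linL: "bounded_linear L"
    and w: "\<And>s. s \<ge> 1 \<Longrightarrow> (w has_vector_derivative (1 / s) *\<^sub>R (v s - T (w s))) (at s)"
    and v: "\<And>s. s \<ge> 1 \<Longrightarrow>
      (v has_vector_derivative (1 / s) *\<^sub>R L (v s - T (w s)) - S (v s)) (at s)"
  shows "\<exists>C. \<forall>s\<ge>1. norm (w s) \<le> C"
proof -
  note p = lyapunov_formD[OF T] and q = lyapunov_formD[OF S]
  interpret p: bounded_bilinear p by (rule p(1))
  interpret q: bounded_bilinear q by (rule q(1))
  interpret L: bounded_linear L by (rule linL)
  obtain c1 where c1: "c1 > 0" "\<And>x y. norm (p x y) \<le> norm x * norm y * c1"
    using p.pos_bounded by auto
  obtain c2 where c2: "c2 > 0" "\<And>x y. norm (q x (L y)) \<le> norm x * norm y * c2"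
    using bounded_bilinear.pos_bounded[OF bounded_bilinear.comp[OF q(1) bounded_linear_ident linL]] by auto
  obtain c3 where c3: "c3 > 0" "\<And>x y. norm (q x (L (T y))) \<le> norm x * norm y * c3"
    using bounded_bilinear.pos_bounded[OF bounded_bilinear.comp[OF q(1) bounded_linear_ident
          bounded_linear_compose[OF linL linT]]] by auto
  \<comment> \<open>\<open>k\<close> collects the two cross terms of size |w| |v|. Young's
    inequality spends the whole damping a |w|^2 on them and leaves k^2 / (4a) |v|^2; from
    \<open>s0\<close> on, this and c2 |v|^2 are absorbed by the damping s b |v|^2.\<close>
  define k where "k = c1 + c3"
  define s0 where "s0 = max 1 ((c2 + k\<^sup>2 / (4 * a)) / b)"
  have s0: "s0 \<ge> 1" "s0 * b \<ge> c2 + k\<^sup>2 / (4 * a)"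
  proof -
    have "(c2 + k\<^sup>2 / (4 * a)) / b \<le> s0" by (simp add: s0_def)
    then show "s0 * b \<ge> c2 + k\<^sup>2 / (4 * a)" using q(3) by (simp add: pos_divide_le_eq)
  qed (simp add: s0_def)
  define E where "E s = p (w s) (w s) + q (v s) (v s)" for s
  have E: "E s \<le> E s0" if "s0 \<le> s" for s
  proof (rule DERIV_nonpos_imp_nonincreasing[OF that])
    fix x assume x: "s0 \<le> x" "x \<le> s"
    then have x1: "x \<ge> 1" using s0 by simp
    let ?w = "w x" and ?v = "v x"
    let ?w' = "(1 / x) *\<^sub>R (?v - T ?w)" and ?v' = "(1 / x) *\<^sub>R L (?v - T ?w) - S ?v"
    have "(E has_real_derivative (2 * p ?w ?w' + 2 * q ?v ?v')) (at x)"
      using has_vector_derivative_add[OF p.has_vector_derivative[OF w w] q.has_vector_derivative[OF v v], OF x1 x1 x1 x1]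
      unfolding has_real_derivative_iff_has_vector_derivative E_def
      by (simp only: p(2)[of ?w'] q(2)[of ?v'] mult_2)
    moreover have "2 * p ?w ?w' + 2 * q ?v ?v' \<le> 0"
    proof -
      have 1: "p ?w ?w' = (p ?w ?v - p ?w (T ?w)) / x" by (simp add: p.scaleR_right p.diff_right)
      have 2: "q ?v ?v' = (q ?v (L ?v) - q ?v (L (T ?w))) / x - q ?v (S ?v)"
        by (simp add: q.scaleR_right q.diff_right L.diff)
      define \<alpha> \<beta> where "\<alpha> = norm ?w" and "\<beta> = norm ?v"
      have "p ?w ?v \<le> \<alpha> * \<beta> * c1" using c1(2)[of ?w ?v] by (simp add: \<alpha>_def \<beta>_def)
      moreover have "p ?w (T ?w) \<ge> a * \<alpha>\<^sup>2" using p(5)[of ?w] by (simp add: \<alpha>_def)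
      moreover have "q ?v (L ?v) \<le> \<beta>\<^sup>2 * c2"
        using c2(2)[of ?v ?v] by (simp add: \<beta>_def power2_eq_square)
      moreover have "- q ?v (L (T ?w)) \<le> \<alpha> * \<beta> * c3"
        using c3(2)[of ?v ?w] by (simp add: \<alpha>_def \<beta>_def mult_ac)
      ultimately have "(p ?w ?v - p ?w (T ?w)) + (q ?v (L ?v) - q ?v (L (T ?w)))
          \<le> k * \<alpha> * \<beta> - a * \<alpha>\<^sup>2 + c2 * \<beta>\<^sup>2"
        by (simp add: k_def algebra_simps)
      also have "k * \<alpha> * \<beta> \<le> a * \<alpha>\<^sup>2 + k\<^sup>2 / (4 * a) * \<beta>\<^sup>2"
      proof -
        have "0 \<le> (2 * a * \<alpha> - k * \<beta>)\<^sup>2" by simp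
        also have "\<dots> = 4 * a * (a * \<alpha>\<^sup>2 - k * \<alpha> * \<beta>) + k\<^sup>2 * \<beta>\<^sup>2"
          by (simp add: power2_eq_square algebra_simps)
        finally show ?thesis using p(3) by (simp add: field_simps)
      qed
      finally have "(p ?w ?v - p ?w (T ?w)) + (q ?v (L ?v) - q ?v (L (T ?w)))
          \<le> (c2 + k\<^sup>2 / (4 * a)) * \<beta>\<^sup>2" by (simp add: algebra_simps)
      also have "\<dots> \<le> (x * b) * \<beta>\<^sup>2"
      proof (rule mult_right_mono)
        have "s0 * b \<le> x * b" using x q(3) by (intro mult_right_mono) auto
        then show "c2 + k\<^sup>2 / (4 * a) \<le> x * b" using s0 by simp
      qed simp
      also have "\<dots> \<le> x * q ?v (S ?v)" using q(5)[of ?v] x1 by (simp add: \<beta>_def mult.assoc)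
      finally have "(p ?w ?v - p ?w (T ?w)) + (q ?v (L ?v) - q ?v (L (T ?w))) - x * q ?v (S ?v) \<le> 0"
        by simp
      moreover have "x * (p ?w ?w' + q ?v ?v')
          = (p ?w ?v - p ?w (T ?w)) + (q ?v (L ?v) - q ?v (L (T ?w))) - x * q ?v (S ?v)"
        unfolding 1 2 distrib_left right_diff_distrib using x1 by simp
      ultimately have "x * (p ?w ?w' + q ?v ?v') \<le> 0" by simp
      then have "p ?w ?w' + q ?v ?v' \<le> 0" using x1 by (simp add: mult_le_0_iff)
      then show ?thesis by simp
    qed
    ultimately show "\<exists>y. (E has_real_derivative y) (at x) \<and> y \<le> 0" by blast
  qed
  \<comment> \<open>Before \<open>s0\<close> the energy may grow; there compactness bounds
    \<open>w\<close>.\<close>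
  have "continuous_on {1..s0} w"
    by (auto intro!: continuous_at_imp_continuous_on has_vector_derivative_continuous w)
  then have "bounded (w ` {1..s0})"
    by (intro compact_imp_bounded compact_continuous_image) auto
  then obtain C where C: "\<forall>s\<in>{1..s0}. norm (w s) \<le> C"
    by (auto simp: bounded_iff)
  show ?thesis
  proof (intro exI allI impI)
    fix s :: real assume s: "s \<ge> 1"
    show "norm (w s) \<le> max C (sqrt (E s0))"
    proof (cases "s \<le> s0")
      case True
      then show ?thesis using C s by (simp add: le_max_iff_disj)
    next
      case False
      have "0 \<le> q (v s) (v s)" by (rule order_trans[OF zero_le_power2 q(4)])
      then have "(norm (w s))\<^sup>2 \<le> E s" using p(4)[of "w s"] by (simp add: E_def)
      also have "\<dots> \<le> E s0" using False by (intro E) simp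
      finally show ?thesis by (simp add: real_le_rsqrt le_max_iff_disj)
    qed
  qed
qed

text \<open>Coefficient form of the hypergeometric equation, with \<open>T\<close>,
  \<open>S\<close>, \<open>B\<close> standing for the actions of A, Y and B. The minus sign of the
  equation is carried by the powers of -s in \<open>w\<close>. The space is abstract so that
  tensor-valued coefficients fit.\<close>

locale hypergeometric_recurrence =
  fixes t :: "nat \<Rightarrow> 'v::euclidean_space" and T S B :: "'v \<Rightarrow> 'v"
  assumes T: "bounded_linear T" and S: "bounded_linear S" and B: "bounded_linear B"
    and ST: "S (T x) = T (S x)"
    and rec: "real (Suc n) *\<^sub>R (B (t (Suc n)) + real n *\<^sub>R t (Suc n)) = S (T (t n) + real n *\<^sub>R t n)"
begin

sublocale T: bounded_linear T by (rule T)
sublocale S: bounded_linear S by (rule S)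
sublocale B: bounded_linear B by (rule B)

lemma summable_coeffs:
  assumes "s \<ge> 0"
  shows "summable (\<lambda>n. norm (t n) * s ^ n)"
proof -
  obtain a where a: "a > 0" "\<And>x. norm (T x) \<le> norm x * a" using T.pos_bounded by auto
  obtain c where c: "c > 0" "\<And>x. norm (S x) \<le> norm x * c" using S.pos_bounded by auto
  obtain b where b: "b > 0" "\<And>x. norm (B x) \<le> norm x * b" using B.pos_bounded by auto
  \<comment> \<open>For n > b one has |Bx + nx| >= (n - b) |x|, so the recurrence controls the next
    coefficient with a ratio of order 1/n.\<close>
  have "\<forall>\<^sub>F n in sequentially. real n > b"
    by real_asymp
  then have "\<forall>\<^sub>F n in sequentially. norm (t (Suc n))
      \<le> (c * ((a + real n) / (1 + real n)) * (1 / (real n - b))) * norm (t n)"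
  proof eventually_elim
    case (elim n)
    have "(1 + real n) * ((real n - b) * norm (t (Suc n)))
        \<le> real (Suc n) * norm (B (t (Suc n)) + real n *\<^sub>R t (Suc n))"
    proof (rule mult_mono)
      have "norm (real n *\<^sub>R t (Suc n)) \<le> norm (B (t (Suc n)) + real n *\<^sub>R t (Suc n)) + norm (B (t (Suc n)))"
        using norm_triangle_ineq4[of "B (t (Suc n)) + real n *\<^sub>R t (Suc n)" "B (t (Suc n))"] by simp
      then show "(real n - b) * norm (t (Suc n)) \<le> norm (B (t (Suc n)) + real n *\<^sub>R t (Suc n))"
        using b(2)[of "t (Suc n)"] by (simp add: algebra_simps)
    qed (use elim in auto)
    also have "\<dots> = norm (S (T (t n) + real n *\<^sub>R t n))"
      using arg_cong[OF rec[of n], of norm] by simp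
    also have "\<dots> \<le> norm (T (t n) + real n *\<^sub>R t n) * c" by (rule c(2))
    also have "\<dots> \<le> (norm (t n) * a + real n * norm (t n)) * c"
      using norm_triangle_ineq[of "T (t n)" "real n *\<^sub>R t n"] a(2)[of "t n"] c(1)
      by (intro mult_right_mono) auto
    finally have "((1 + real n) * (real n - b)) * norm (t (Suc n)) \<le> c * (a + real n) * norm (t n)"
      by (simp add: algebra_simps)
    then have "norm (t (Suc n)) \<le> c * (a + real n) * norm (t n) / ((1 + real n) * (real n - b))"
      using elim by (subst pos_le_divide_eq) (auto simp: mult.commute)
    then show ?case by simp
  qed
  moreover have "(\<lambda>n. c * ((a + real n) / (1 + real n)) * (1 / (real n - b))) \<longlonglongrightarrow> c * 1 * 0"
    by (intro tendsto_mult tendsto_const) real_asymp+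
  ultimately show ?thesis
    using assms by (intro summable_ratio_limit) auto
qed

definition w :: "real \<Rightarrow> 'v" where "w s = (\<Sum>n. (- s) ^ n *\<^sub>R t n)"

lemma sums_w: "(\<lambda>n. (- s) ^ n *\<^sub>R t n) sums w s"
  unfolding w_def by (intro summable_sums powser_summable[where K = "\<bar>s\<bar> + 1"] summable_coeffs) auto

lemma continuous_on_w: "continuous_on A w"
proof (intro continuous_at_imp_continuous_on ballI)
  fix s
  have "((\<lambda>s. \<Sum>n. s ^ n *\<^sub>R t n) has_vector_derivative
      (\<Sum>n. (- s) ^ n *\<^sub>R (real (Suc n) *\<^sub>R t (Suc n)))) (at (- s))"
    by (rule powser_has_vector_derivative[where K = "\<bar>s\<bar> + 1"]) (auto intro: summable_coeffs)
  then have "isCont (\<lambda>s. \<Sum>n. s ^ n *\<^sub>R t n) (- s)" by (rule has_vector_derivative_continuous)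
  then show "isCont w s"
    unfolding w_def[abs_def] by (rule isCont_o2[rotated]) simp
qed

lemma bounded_w:
  assumes "lyapunov_form T p a" and "lyapunov_form S q b"
  shows "\<exists>C. \<forall>s\<ge>1. norm (w s) \<le> C"
proof -
  \<comment> \<open>\<open>u\<close> absorbs the sign and makes \<open>w\<close> a power series in
    s; \<open>y\<close> holds the coefficients of v = (theta + T) w, and \<open>L\<close> comes from
    theta v = (1 + T - B) theta w - s S v.\<close>
  define u where "u n = (- 1) ^ n *\<^sub>R t n" for n
  define y where "y n = real n *\<^sub>R u n + T (u n)" for n
  define L where "L x = x + T x - B x" for x
  define v where "v s = (\<Sum>n. s ^ n *\<^sub>R y n)" for s
  interpret L: bounded_linear L
    unfolding L_def by (intro bounded_linear_sub bounded_linear_add bounded_linear_ident T B)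
  have w: "w s = (\<Sum>n. s ^ n *\<^sub>R u n)" for s
    unfolding w_def u_def by (subst power_minus) (simp add: mult.commute)
  have cu: "summable (\<lambda>n. norm (u n) * s ^ n)" if "s \<ge> 0" for s
    using summable_coeffs[OF that] by (simp add: u_def)
  have cu': "summable (\<lambda>n. norm (real (Suc n) *\<^sub>R u (Suc n)) * s ^ n)" if "s \<ge> 0" for s
    by (rule powser_termdiff_norm_summable[where K = "s + 1"]) (use that cu in auto)
  have cnu: "summable (\<lambda>n. norm (real n *\<^sub>R u n) * s ^ n)" if "s \<ge> 0" for s
  proof (subst summable_Suc_iff[symmetric])
    show "summable (\<lambda>n. norm (real (Suc n) *\<^sub>R u (Suc n)) * s ^ Suc n)"
      using summable_mult2[OF cu'[OF that], of s] by (simp add: mult_ac)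
  qed
  have cy: "summable (\<lambda>n. norm (y n) * s ^ n)" if "s \<ge> 0" for s
  proof -
    obtain K where K: "K > 0" "\<And>x. norm (T x) \<le> norm x * K" using T.pos_bounded by auto
    have "norm (norm (y n) * s ^ n) \<le> norm (real n *\<^sub>R u n) * s ^ n + K * (norm (u n) * s ^ n)" for n
    proof -
      have "norm (y n) \<le> norm (real n *\<^sub>R u n) + K * norm (u n)"
        using norm_triangle_ineq[of "real n *\<^sub>R u n" "T (u n)"] K(2)[of "u n"]
        by (simp add: y_def mult.commute)
      from mult_right_mono[OF this, of "s ^ n"] that show ?thesis by (simp add: algebra_simps)
    qed
    then show ?thesis
      by (intro summable_comparison_test'[OF summable_add[OF cnu[OF that] summable_mult[OF cu[OF that]]]])
  qed
  \<comment> \<open>The differential equation for v, compared at s^n.\<close>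
  have yrec: "y' = L (real (Suc n) *\<^sub>R u (Suc n)) - S (y n)" if "y' = real (Suc n) *\<^sub>R y (Suc n)" for n y'
  proof -
    define e :: real where "e = (- 1) ^ n"
    have "B (u (Suc n)) + real n *\<^sub>R u (Suc n) = (- e) *\<^sub>R (B (t (Suc n)) + real n *\<^sub>R t (Suc n))"
    proof -
      have "u (Suc n) = (- e) *\<^sub>R t (Suc n)" by (simp add: u_def e_def)
      then show ?thesis by (simp only: B.scaleR scaleR_add_right scaleR_scaleR mult.commute)
    qed
    moreover have "T (u n) + real n *\<^sub>R u n = e *\<^sub>R (T (t n) + real n *\<^sub>R t n)"
      by (simp add: u_def e_def T.scaleR scaleR_add_right mult.commute)
    ultimately have "real (Suc n) *\<^sub>R (B (u (Suc n)) + real n *\<^sub>R u (Suc n)) = - S (T (u n) + real n *\<^sub>R u n)"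
      using arg_cong[OF rec[of n], of "\<lambda>x. (- e) *\<^sub>R x"] by (simp only: S.scaleR) (simp add: mult.commute)
    then have "S (y n) = - (real (Suc n) *\<^sub>R (B (u (Suc n)) + real n *\<^sub>R u (Suc n)))"
      by (simp add: y_def add.commute)
    then show ?thesis
      unfolding that L.scaleR by (simp add: L_def y_def algebra_simps)
  qed
  have sm: "summable (\<lambda>n. s ^ n *\<^sub>R z n)" if "\<And>s. s \<ge> 0 \<Longrightarrow> summable (\<lambda>n. norm (z n) * s ^ n)"
    for s and z :: "nat \<Rightarrow> 'v"
    by (rule powser_summable[where K = "\<bar>s\<bar> + 1"]) (use that in auto)
  have smu: "summable (\<lambda>n. s ^ n *\<^sub>R u n)" for s using cu by (rule sm)
  have smu': "summable (\<lambda>n. s ^ n *\<^sub>R (real (Suc n) *\<^sub>R u (Suc n)))" for s using cu' by (rule sm)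
  have smnu: "summable (\<lambda>n. s ^ n *\<^sub>R (real n *\<^sub>R u n))" for s using cnu by (rule sm)
  have smy: "summable (\<lambda>n. s ^ n *\<^sub>R y n)" for s using cy by (rule sm)
  have der: "((\<lambda>s. \<Sum>n. s ^ n *\<^sub>R z n) has_vector_derivative
      (\<Sum>n. s ^ n *\<^sub>R (real (Suc n) *\<^sub>R z (Suc n)))) (at s)"
    if "\<And>s. s \<ge> 0 \<Longrightarrow> summable (\<lambda>n. norm (z n) * s ^ n)" for s and z :: "nat \<Rightarrow> 'v"
    by (rule powser_has_vector_derivative[where K = "\<bar>s\<bar> + 1"]) (use that in auto)
  let ?w' = "\<lambda>s. \<Sum>n. s ^ n *\<^sub>R (real (Suc n) *\<^sub>R u (Suc n))"
  \<comment> \<open>v - T w is theta w, whose constant term vanishes, so a factor s can be pulled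
    out.\<close>
  have w': "(1 / s) *\<^sub>R (v s - T (w s)) = ?w' s" if "s \<ge> 1" for s
  proof -
    have "v s - T (w s) = (\<Sum>n. s ^ n *\<^sub>R y n - T (s ^ n *\<^sub>R u n))"
      unfolding v_def w T.suminf[OF smu]
      by (rule suminf_diff[OF smy T.summable[OF smu]])
    also have "\<dots> = (\<Sum>n. s ^ n *\<^sub>R (real n *\<^sub>R u n))"
      by (simp add: y_def T.scaleR scaleR_add_right)
    also have "\<dots> = (\<Sum>n. s ^ Suc n *\<^sub>R (real (Suc n) *\<^sub>R u (Suc n)))"
      using suminf_split_head[OF smnu, of s] by simp
    also have "\<dots> = s *\<^sub>R ?w' s"
      by (subst suminf_scaleR_right[OF smu']) (simp add: mult.assoc del: of_nat_Suc)
    finally show ?thesis using that by simp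
  qed
  have v': "(1 / s) *\<^sub>R L (v s - T (w s)) - S (v s)
      = (\<Sum>n. s ^ n *\<^sub>R (real (Suc n) *\<^sub>R y (Suc n)))" if "s \<ge> 1" for s
  proof -
    have "(1 / s) *\<^sub>R L (v s - T (w s)) - S (v s)
        = (\<Sum>n. L (s ^ n *\<^sub>R (real (Suc n) *\<^sub>R u (Suc n))) - S (s ^ n *\<^sub>R y n))"
      unfolding L.scaleR[symmetric] w'[OF that] unfolding v_def L.suminf[OF smu'] S.suminf[OF smy]
      by (rule suminf_diff[OF L.summable[OF smu'] S.summable[OF smy]])
    also have "\<dots> = (\<Sum>n. s ^ n *\<^sub>R (L (real (Suc n) *\<^sub>R u (Suc n)) - S (y n)))"
      by (simp only: L.scaleR S.scaleR scaleR_diff_right)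
    finally show ?thesis by (simp only: yrec[OF refl])
  qed
  show ?thesis
  proof (rule damped_system_bounded[OF assms T L.bounded_linear_axioms])
    fix s :: real assume s: "s \<ge> 1"
    show "(w has_vector_derivative (1 / s) *\<^sub>R (v s - T (w s))) (at s)"
      unfolding w'[OF s] unfolding w[abs_def] using cu by (rule der)
    show "(v has_vector_derivative (1 / s) *\<^sub>R L (v s - T (w s)) - S (v s)) (at s)"
      unfolding v'[OF s] unfolding v_def[abs_def] using cy by (rule der)
  qed
qed

end

section \<open>Coefficients of the matrix series 1F1\<close>

lemma matrix_inv_mult:
  fixes M :: "complex^'n^'n"
  assumes "invertible M"
  shows "matrix_inv M ** M = mat 1" "M ** matrix_inv M = mat 1"
  using assms unfolding invertible_def matrix_inv_def by (metis (mono_tags, lifting) someI_ex)+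

lemma invertible_positive_stable_shift:
  fixes B :: "complex^'n^'n"
  assumes "positive_stable B"
  shows "invertible (B + mat (of_nat n))"
  unfolding invertible_left_inverse matrix_left_invertible_ker
proof (intro allI impI)
  fix v assume v: "(B + mat (of_nat n)) *v v = 0"
  have "(mat (of_nat n) :: complex^'n^'n) *v v = of_nat n *s v"
    by (simp add: mat_def matrix_vector_mult_def vec_eq_iff mult_delta_left)
  with v have Bv: "B *v v = (- of_nat n) *s v"
    by (simp add: matrix_vector_mult_add_rdistrib eq_neg_iff_add_eq_0 vec_eq_iff)
  show "v = 0"
  proof (rule ccontr)
    assume "v \<noteq> 0"
    with assms Bv have "Re (- of_nat n) > 0" unfolding positive_stable_def by blast
    then show False by simp
  qed
qed

lemma mat_pochhammer_commute:
  "mat_pochhammer A n ** (A + mat c) = (A + mat c) ** mat_pochhammer A n"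
proof (induction n)
  case (Suc n)
  have "(A + mat (of_nat n)) ** (A + mat c) = (A + mat c) ** (A + mat (of_nat n))"
    by (simp add: mm.add_left mm.add_right mat_mult_commute[of A] add_ac mult.commute flip: mat_mult)
  then show ?case
    using Suc by simp (metis matrix_mul_assoc)
qed simp

lemma invertible_mat_pochhammer:
  assumes "positive_stable B"
  shows "invertible (mat_pochhammer B n)"
proof (induction n)
  case 0
  show ?case by (auto simp: invertible_def)
next
  case (Suc n)
  then show ?case using invertible_positive_stable_shift[OF assms, of n] by (simp add: invertible_mult)
qed

definition hyp1F1_coeff :: "complex^'n^'n \<Rightarrow> complex^'n^'n \<Rightarrow> nat \<Rightarrow> complex^'n^'n" where
  "hyp1F1_coeff A B n = (mat_pochhammer A n ** matrix_inv (mat_pochhammer B n)) /\<^sub>R fact n"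

text \<open>The last factor of (A)_(n+1) moves to the left end, while B + n cancels against the
  inverse at the right end. \<open>A\<close> and \<open>B\<close> act from opposite sides and never
  have to pass each other.\<close>

lemma hyp1F1_coeff_rec:
  assumes "positive_stable B"
  shows "real (Suc n) *\<^sub>R (hyp1F1_coeff A B (Suc n) ** (B + mat (of_nat n)))
    = (A + mat (of_nat n)) ** hyp1F1_coeff A B n"
proof -
  let ?X = "mat_pochhammer B n" and ?N = "B + mat (of_nat n)"
  have X: "invertible ?X" and "invertible ?N" and XN: "invertible (mat_pochhammer B (Suc n))"
    using invertible_mat_pochhammer[OF assms] invertible_positive_stable_shift[OF assms] by blast+
  have "matrix_inv (mat_pochhammer B (Suc n)) ** (?N ** ?X) = mat 1"
    using matrix_inv_mult(1)[OF XN] by (simp add: mat_pochhammer_commute)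
  then have "matrix_inv (mat_pochhammer B (Suc n)) ** ?N ** (?X ** matrix_inv ?X) = matrix_inv ?X"
    by (metis matrix_mul_assoc matrix_mul_lid)
  then have inv: "matrix_inv (mat_pochhammer B (Suc n)) ** ?N = matrix_inv ?X"
    by (simp add: matrix_inv_mult(2)[OF X])
  have "real (Suc n) *\<^sub>R (hyp1F1_coeff A B (Suc n) ** ?N)
      = (mat_pochhammer A (Suc n) ** (matrix_inv (mat_pochhammer B (Suc n)) ** ?N)) /\<^sub>R fact n"
    by (simp add: hyp1F1_coeff_def mm.scaleR_left matrix_mul_assoc del: mat_pochhammer.simps)
  also have "\<dots> = (A + mat (of_nat n)) ** hyp1F1_coeff A B n"
    unfolding inv by (simp add: hyp1F1_coeff_def mm.scaleR_right mat_pochhammer_commute matrix_mul_assoc)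
  finally show ?thesis .
qed

text \<open>In \<open>(A)\<^sub>n (B)\<^sub>n\<^sup>-\<^sup>1 Y\<^sup>n\<close> the recurrence in \<open>n\<close> acts on \<open>(A)\<^sub>n (B)\<^sub>n\<^sup>-\<^sup>1\<close> from both sides, so it is blocked by
  \<open>Y\<^sup>n\<close>. The tensor product of \<open>(A)\<^sub>n (B)\<^sub>n\<^sup>-\<^sup>1\<close> with a column of \<open>Y\<^sup>n\<close> carries commuting actions of
  \<open>A\<close>, \<open>B\<close> and \<open>Y\<close> and therefore satisfies a linear recurrence; contraction recovers the product.\<close>

definition tensor :: "complex^'n^'n \<Rightarrow> complex^'n \<Rightarrow> complex^'n^'n^'n" where
  "tensor C v = (\<chi> k i l. C $ i $ k * v $ l)"

text \<open>The column index of the matrix slot is outermost, so each slice \<open>x $ k\<close> is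
  an ordinary matrix and left multiplication of that slot is \<open>**\<close> on slices.\<close>

definition act_fst :: "complex^'n^'n \<Rightarrow> complex^'n^'n^'n \<Rightarrow> complex^'n^'n^'n" where
  "act_fst M x = (\<chi> k. M ** x $ k)"

definition act_fst_right :: "complex^'n^'n \<Rightarrow> complex^'n^'n^'n \<Rightarrow> complex^'n^'n^'n" where
  "act_fst_right M x = (\<chi> k i l. \<Sum>j\<in>UNIV. x $ j $ i $ l * M $ j $ k)"

definition act_snd :: "complex^'n^'n \<Rightarrow> complex^'n^'n^'n \<Rightarrow> complex^'n^'n^'n" where
  "act_snd M x = (\<chi> k i. M *v x $ k $ i)"

text \<open>Pairing the column index with the vector index sends \<open>tensor C v\<close> to the
  vector C v, stored as column \<open>j\<close>. For v = Y^n e_j the sum over \<open>j\<close>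
  rebuilds C Y^n.\<close>

definition contract :: "'n \<Rightarrow> complex^'n^'n^'n \<Rightarrow> complex^'n^'n" where
  "contract j x = (\<chi> i j'. if j' = j then \<Sum>k\<in>UNIV. x $ k $ i $ k else 0)"

lemmas tensor_defs = tensor_def act_fst_def act_fst_right_def act_snd_def contract_def
  matrix_matrix_mult_def matrix_vector_mult_def vec_eq_iff

lemma act_fst_tensor: "act_fst M (tensor C v) = tensor (M ** C) v"
  and act_fst_right_tensor: "act_fst_right M (tensor C v) = tensor (C ** M) v"
  and act_snd_tensor: "act_snd M (tensor C v) = tensor C (M *v v)"
  by (simp_all add: tensor_defs sum_distrib_left sum_distrib_right mult_ac)

lemma tensor_add: "tensor (C + D) v = tensor C v + tensor D v"
  and tensor_scaleR: "tensor (r *\<^sub>R C) v = r *\<^sub>R tensor C v"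
  by (simp_all add: tensor_defs algebra_simps)

lemma bounded_linear_act_fst_right: "bounded_linear (act_fst_right M)"
  and bounded_linear_contract: "bounded_linear (contract j)"
  by (intro linear_conv_bounded_linear[THEN iffD1] linearI;
      simp add: tensor_defs sum.distrib algebra_simps scaleR_sum_right)+

text \<open>Transfers positive stability of \<open>A\<close> to its action on tensors, where the
  damped system lives; \<open>matrix_rep_act_snd\<close> does the same for \<open>Y\<close>.\<close>

lemma matrix_rep_act_fst: "matrix_rep act_fst"
proof
  show "bilinear act_fst"
    unfolding bilinear_def
    by (auto intro!: linearI simp: act_fst_def vec_eq_iff[where x = "vec_lambda _"]
        mm.add_left mm.add_right mm.scaleR_left mm.scaleR_right)
  show "x \<bullet> act_fst (mat \<i>) x = 0" for x :: "complex^'n^'n^'n"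
    by (simp add: act_fst_def inner_vec_def[of x] inner_mat_imaginary)
qed (simp_all add: act_fst_def matrix_mul_assoc)

lemma matrix_rep_act_snd: "matrix_rep act_snd"
proof
  show "bilinear act_snd"
    unfolding bilinear_def
    by (auto intro!: linearI simp: tensor_defs algebra_simps sum.distrib scaleR_sum_right)
  show "x \<bullet> act_snd (mat \<i>) x = 0" for x :: "complex^'n^'n^'n"
    by (simp add: act_snd_def inner_vec_def matrix_vector_mult_def mat_def mult_delta_left inner_complex_def)
qed (simp_all add: act_snd_def matrix_vector_mul_assoc)

lemma bounded_linear_matrix_rep: "matrix_rep R \<Longrightarrow> bounded_linear (R M)"
  using matrix_rep.bilin bilinear_conv_bounded_bilinear bounded_bilinear.bounded_linear_right by blast

context
  fixes A B Y :: "complex^'n^'n"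
  assumes B: "positive_stable B"
begin

definition hyp1F1_tensor :: "'n \<Rightarrow> nat \<Rightarrow> complex^'n^'n^'n" where
  "hyp1F1_tensor j n = tensor (hyp1F1_coeff A B n) (mat_power Y n *v axis j 1)"

lemma hypergeometric_recurrence_hyp1F1_tensor:
  "hypergeometric_recurrence (hyp1F1_tensor j) (act_fst A) (act_snd Y) (act_fst_right B)"
proof (rule hypergeometric_recurrence.intro)
  show "bounded_linear (act_fst A)" "bounded_linear (act_snd Y)"
    by (rule bounded_linear_matrix_rep[OF matrix_rep_act_fst] bounded_linear_matrix_rep[OF matrix_rep_act_snd])+
  show "bounded_linear (act_fst_right B)" by (rule bounded_linear_act_fst_right)
  show "act_snd Y (act_fst A x) = act_fst A (act_snd Y x)" for x
    unfolding tensor_defs by (simp add: sum_distrib_left, subst sum.swap, simp add: mult_ac)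
  fix n
  let ?c = "hyp1F1_coeff A B" and ?y = "\<lambda>n. mat_power Y n *v axis j 1"
  have "real (Suc n) *\<^sub>R (act_fst_right B (hyp1F1_tensor j (Suc n)) + real n *\<^sub>R hyp1F1_tensor j (Suc n))
     = tensor (real (Suc n) *\<^sub>R (?c (Suc n) ** (B + mat (of_nat n)))) (?y (Suc n))"
    by (simp only: hyp1F1_tensor_def act_fst_right_tensor tensor_add tensor_scaleR mm.add_right mult_mat_of_nat)
  also have "\<dots> = tensor ((A + mat (of_nat n)) ** ?c n) (Y *v ?y n)"
    unfolding hyp1F1_coeff_rec[OF B] mat_power_Suc2 matrix_vector_mul_assoc ..
  also have "\<dots> = act_snd Y (act_fst A (hyp1F1_tensor j n) + real n *\<^sub>R hyp1F1_tensor j n)"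
    unfolding hyp1F1_tensor_def act_fst_tensor tensor_scaleR[symmetric] tensor_add[symmetric]
      act_snd_tensor mm.add_left mat_of_nat_mult ..
  finally show "real (Suc n) *\<^sub>R (act_fst_right B (hyp1F1_tensor j (Suc n)) + real n *\<^sub>R hyp1F1_tensor j (Suc n))
     = act_snd Y (act_fst A (hyp1F1_tensor j n) + real n *\<^sub>R hyp1F1_tensor j n)" .
qed

lemma sum_contract_hyp1F1_tensor:
  "(\<Sum>j\<in>UNIV. contract j (hyp1F1_tensor j n)) = hyp1F1_coeff A B n ** mat_power Y n"
  by (simp add: hyp1F1_tensor_def tensor_defs axis_def mult_delta_right cong: if_cong)

lemma hyp1F1_mat_eq_contract:
  "hyp1F1_mat A B (- (s *\<^sub>R Y))
    = (\<Sum>j\<in>UNIV. contract j (hypergeometric_recurrence.w (hyp1F1_tensor j) s))"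
proof -
  have sums: "(\<lambda>n. \<Sum>j\<in>UNIV. contract j ((- s) ^ n *\<^sub>R hyp1F1_tensor j n)) sums
      (\<Sum>j\<in>UNIV. contract j (hypergeometric_recurrence.w (hyp1F1_tensor j) s))"
    by (intro sums_sum bounded_linear.sums[OF bounded_linear_contract]
        hypergeometric_recurrence.sums_w[OF hypergeometric_recurrence_hyp1F1_tensor])
  have summand: "(\<Sum>j\<in>UNIV. contract j ((- s) ^ n *\<^sub>R hyp1F1_tensor j n))
      = (mat_pochhammer A n ** matrix_inv (mat_pochhammer B n) ** mat_power (- (s *\<^sub>R Y)) n) /\<^sub>R fact n" for n
  proof -
    have "mat_power (- (s *\<^sub>R Y)) n = (- s) ^ n *\<^sub>R mat_power Y n"
      using mat_power_cscale[of "of_real (- s)" Y n]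
      unfolding of_real_power[symmetric] cscale_of_real by simp
    then show ?thesis
      by (simp add: linear_scale[OF bounded_linear.linear[OF bounded_linear_contract]] sum_contract_hyp1F1_tensor
          hyp1F1_coeff_def mm.scaleR_left mm.scaleR_right flip: scaleR_sum_right)
  qed
  show ?thesis
    using sums_unique[OF sums[unfolded summand]] unfolding hyp1F1_mat_def by simp
qed

lemma continuous_on_hyp1F1_mat: "continuous_on S (\<lambda>s. hyp1F1_mat A B (- (s *\<^sub>R Y)))"
  unfolding hyp1F1_mat_eq_contract
  by (intro continuous_intros bounded_linear.continuous_on[OF bounded_linear_contract]
      hypergeometric_recurrence.continuous_on_w[OF hypergeometric_recurrence_hyp1F1_tensor])

lemma hyp1F1_mat_bounded:
  assumes "positive_stable A" "positive_stable Y"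
  shows "\<exists>C. \<forall>s\<ge>1. norm (hyp1F1_mat A B (- (s *\<^sub>R Y))) \<le> C"
proof -
  obtain p a q b where "lyapunov_form (act_fst A) p a" "lyapunov_form (act_snd Y) q b"
    using matrix_rep.ex_lyapunov_form[OF matrix_rep_act_fst assms(1)]
      matrix_rep.ex_lyapunov_form[OF matrix_rep_act_snd assms(2)] by blast
  then have "\<forall>j. \<exists>C. \<forall>s\<ge>1. norm (hypergeometric_recurrence.w (hyp1F1_tensor j) s) \<le> C"
    using hypergeometric_recurrence.bounded_w[OF hypergeometric_recurrence_hyp1F1_tensor] by blast
  then obtain C where C: "\<And>j s. s \<ge> 1 \<Longrightarrow> norm (hypergeometric_recurrence.w (hyp1F1_tensor j) s) \<le> C j"
    by metis
  have "\<forall>j. \<exists>K. K \<ge> 0 \<and> (\<forall>x. norm (contract j x :: complex^'n^'n) \<le> norm x * K)"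
    using bounded_linear.nonneg_bounded[OF bounded_linear_contract] by blast
  then obtain K where K: "\<And>j. K j \<ge> 0" "\<And>j (x :: complex^'n^'n^'n). norm (contract j x) \<le> norm x * K j"
    by metis
  show ?thesis
  proof (intro exI allI impI)
    fix s :: real assume "s \<ge> 1"
    then show "norm (hyp1F1_mat A B (- (s *\<^sub>R Y))) \<le> (\<Sum>j\<in>UNIV. C j * K j)"
      unfolding hyp1F1_mat_eq_contract
      by (intro sum_norm_le order_trans[OF K(2)] mult_right_mono C K(1))
  qed
qed

end

section \<open>The binomial series and the integral representations\<close>

lemma norm_mult_of_real_less_1:
  "norm z < 1 \<Longrightarrow> \<bar>t\<bar> < 1 \<Longrightarrow> norm (z * complex_of_real t) < 1"
  using mult_strict_mono'[of "norm z" 1 "\<bar>t\<bar>" 1] by (simp add: norm_mult)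

lemma one_minus_not_nonpos_Reals:
  assumes "norm (w :: complex) < 1"
  shows "1 - w \<notin> \<real>\<^sub>\<le>\<^sub>0"
proof
  assume "1 - w \<in> \<real>\<^sub>\<le>\<^sub>0"
  then have "Re w \<ge> 1" by (simp add: complex_nonpos_Reals_iff)
  then show False using assms complex_Re_le_cmod[of w] by simp
qed

section \<open>The matrix binomial series\<close>

definition binomial_coeff_mat :: "complex^'n^'n \<Rightarrow> complex \<Rightarrow> nat \<Rightarrow> complex^'n^'n" where
  "binomial_coeff_mat A z n = (z ^ n / fact n) *\<^sub>c mat_pochhammer A n"

lemma binomial_coeff_mat_rec:
  "real (Suc n) *\<^sub>R binomial_coeff_mat A z (Suc n)
    = z *\<^sub>c (A ** binomial_coeff_mat A z n + real n *\<^sub>R binomial_coeff_mat A z n)"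
proof -
  let ?c = "z ^ n / fact n" and ?X = "mat_pochhammer A n"
  have "complex_of_real (real (Suc n)) * (z ^ Suc n / fact (Suc n)) = z * ?c"
    by (simp del: of_nat_Suc)
  then have "real (Suc n) *\<^sub>R binomial_coeff_mat A z (Suc n) = (z * ?c) *\<^sub>c mat_pochhammer A (Suc n)"
    by (simp only: binomial_coeff_mat_def cscale_of_real[symmetric] cscale_cscale)
  also have "mat_pochhammer A (Suc n) = A ** ?X + real n *\<^sub>R ?X"
    by (simp add: mat_pochhammer_commute mm.add_left mat_of_nat_mult)
  also have "(z * ?c) *\<^sub>c (A ** ?X + real n *\<^sub>R ?X) = z *\<^sub>c (?c *\<^sub>c (A ** ?X) + ?c *\<^sub>c (real n *\<^sub>R ?X))"
    by (simp only: cscale_cscale cscale_add_right)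
  finally show ?thesis
    by (simp only: binomial_coeff_mat_def cscale_mult_right cscale_scaleR)
qed

text \<open>The coefficient ratio tends to |z| < 1, so the endpoint s = 1 is included; this later
  bounds all partial sums uniformly on (0, 1).\<close>

lemma summable_binomial_coeff_mat:
  fixes A :: "complex^'n^'n"
  assumes "norm z < 1" "0 \<le> s" "s \<le> 1"
  shows "summable (\<lambda>n. norm (binomial_coeff_mat A z n) * s ^ n)"
proof -
  obtain K where K: "K > 0" "\<And>(A :: complex^'n^'n) (B :: complex^'n^'n). norm (A ** B) \<le> K * norm A * norm B"
    by (rule matrix_mult_norm_bound) blast
  let ?a = "K * norm A" and ?u = "binomial_coeff_mat A z"
  have "norm (?u (Suc n)) \<le> norm z * ((?a + real n) / (1 + real n)) * norm (?u n)" for n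
  proof -
    have "(1 + real n) * norm (?u (Suc n)) = norm (real (Suc n) *\<^sub>R ?u (Suc n))"
      by simp
    also have "\<dots> = norm z * norm (A ** ?u n + real n *\<^sub>R ?u n)"
      by (simp only: binomial_coeff_mat_rec norm_cscale)
    also have "\<dots> \<le> norm z * (?a * norm (?u n) + real n * norm (?u n))"
      using norm_triangle_ineq[of "A ** ?u n" "real n *\<^sub>R ?u n"] K(2)[of A "?u n"]
      by (intro mult_left_mono) auto
    finally show ?thesis by (simp add: field_simps)
  qed
  moreover have "(\<lambda>n. norm z * ((?a + real n) / (1 + real n))) \<longlonglongrightarrow> norm z * 1"
    by (intro tendsto_mult tendsto_const) real_asymp
  moreover have "norm z * 1 * s < 1"
    using assms mult_mono[of "norm z" "norm z" s 1] by simp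
  ultimately show ?thesis
    using assms(2) by (intro summable_ratio_limit) auto
qed

text \<open>The sum h solves (1 - zs) h' = z A h, so (1 - zs)^A h(s) has derivative 0 and keeps its
  value at s = 0, the identity.\<close>

lemma binomial_series_mat:
  fixes A :: "complex^'n^'n"
  assumes z: "norm z < 1" and t: "\<bar>t\<bar> < 1"
  shows "(\<lambda>n. t ^ n *\<^sub>R binomial_coeff_mat A z n) sums cpow_mat (1 - z * of_real t) (- A)"
proof -
  let ?u = "binomial_coeff_mat A z"
  define h where "h s = (\<Sum>n. s ^ n *\<^sub>R ?u n)" for s :: real
  let ?h' = "\<lambda>s :: real. \<Sum>n. s ^ n *\<^sub>R (real (Suc n) *\<^sub>R ?u (Suc n))"
  have conv: "summable (\<lambda>n. norm (?u n) * s ^ n)" if "0 \<le> s" "s < 1" for s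
    by (rule summable_binomial_coeff_mat[OF z]) (use that in auto)
  have smu: "summable (\<lambda>n. s ^ n *\<^sub>R ?u n)" if "\<bar>s\<bar> < 1" for s
    using conv that by (rule powser_summable)
  have smu': "summable (\<lambda>n. s ^ n *\<^sub>R (real (Suc n) *\<^sub>R ?u (Suc n)))" if "\<bar>s\<bar> < 1" for s
    using powser_termdiff_norm_summable[OF conv] that by (rule powser_summable)
  have h: "(h has_vector_derivative ?h' s) (at s)" if "\<bar>s\<bar> < 1" for s
    unfolding h_def[abs_def] using conv that by (rule powser_has_vector_derivative)
  have ode: "(1 - z * of_real s) *\<^sub>c ?h' s = z *\<^sub>c (A ** h s)" if s: "\<bar>s\<bar> < 1" for s
  proof -
    have smn: "summable (\<lambda>n. s ^ n *\<^sub>R (real n *\<^sub>R ?u n))"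
      and sn: "(\<Sum>n. s ^ n *\<^sub>R (real n *\<^sub>R ?u n)) = s *\<^sub>R ?h' s"
    proof -
      have "(\<lambda>n. s *\<^sub>R (s ^ n *\<^sub>R (real (Suc n) *\<^sub>R ?u (Suc n)))) sums (s *\<^sub>R ?h' s)"
        by (intro sums_scaleR_right summable_sums smu' s)
      then have "(\<lambda>n. s ^ Suc n *\<^sub>R (real (Suc n) *\<^sub>R ?u (Suc n))) sums (s *\<^sub>R ?h' s)"
        by (simp add: mult.assoc)
      then have "(\<lambda>n. s ^ n *\<^sub>R (real n *\<^sub>R ?u n)) sums (s *\<^sub>R ?h' s)"
        by (subst (asm) sums_Suc_iff) simp
      then show "summable (\<lambda>n. s ^ n *\<^sub>R (real n *\<^sub>R ?u n))"
        "(\<Sum>n. s ^ n *\<^sub>R (real n *\<^sub>R ?u n)) = s *\<^sub>R ?h' s" by (simp_all add: sums_iff)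
    qed
    have "?h' s = (\<Sum>n. z *\<^sub>c (A ** (s ^ n *\<^sub>R ?u n) + s ^ n *\<^sub>R (real n *\<^sub>R ?u n)))"
      unfolding binomial_coeff_mat_rec by (simp add: mm.scaleR_right scaleR_add_right flip: cscale_scaleR)
    also have "\<dots> = z *\<^sub>c (\<Sum>n. A ** (s ^ n *\<^sub>R ?u n) + s ^ n *\<^sub>R (real n *\<^sub>R ?u n))"
      by (intro bounded_linear.suminf[OF bounded_linear_cscale, symmetric] summable_add smn
          bounded_linear.summable[OF mm.bounded_linear_right] smu s)
    also have "\<dots> = z *\<^sub>c (A ** h s + s *\<^sub>R ?h' s)"
      unfolding sn[symmetric] h_def bounded_linear.suminf[OF mm.bounded_linear_right smu[OF s]]
      by (subst suminf_add) (intro smn bounded_linear.summable[OF mm.bounded_linear_right] smu s refl)+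
    finally have "?h' s = z *\<^sub>c (A ** h s) + (z * of_real s) *\<^sub>c ?h' s"
      by (simp only: cscale_add_right cscale_of_real[symmetric, of s] cscale_cscale)
    then have "?h' s - (z * of_real s) *\<^sub>c ?h' s = z *\<^sub>c (A ** h s)" by (simp only: diff_eq_eq)
    moreover have "(1 - z * of_real s) *\<^sub>c M = M - (z * of_real s) *\<^sub>c M" for M :: "complex^'n^'n"
      by (simp add: vec_eq_iff algebra_simps)
    ultimately show ?thesis by simp
  qed
  let ?p = "\<lambda>s :: real. cpow_mat (1 - z * of_real s) A"
  have "?p t ** h t = ?p 0 ** h 0"
  proof (rule vector_derivative_zero_imp_eq[where S = "{-1<..<1}"])
    fix s :: real assume "s \<in> {-1<..<1}"
    then have s: "\<bar>s\<bar> < 1" by auto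
    let ?c = "1 - z * complex_of_real s"
    have c: "?c \<notin> \<real>\<^sub>\<le>\<^sub>0"
      using norm_mult_of_real_less_1[OF z s] by (rule one_minus_not_nonpos_Reals)
    then have c0: "?c \<noteq> 0" by auto
    have "((\<lambda>s. 1 - z * complex_of_real s) has_vector_derivative - z) (at s)"
      by (auto intro!: derivative_eq_intros)
    from mm.has_vector_derivative[OF cpow_mat_has_vector_derivative[OF this c, of A] h[OF s]]
    have "((\<lambda>s. ?p s ** h s) has_vector_derivative
        ?p s ** ?h' s + (((- z) / ?c) *\<^sub>c A ** ?p s) ** h s) (at s)" .
    moreover have "?p s ** ?h' s = (z / ?c) *\<^sub>c (A ** ?p s) ** h s"
    proof -
      have "?h' s = (1 / ?c) *\<^sub>c (z *\<^sub>c (A ** h s))"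
        unfolding ode[OF s, symmetric] cscale_cscale using c0 by (simp add: cscale_eq_mat_mult)
      then have "?p s ** ?h' s = (z / ?c) *\<^sub>c (?p s ** A ** h s)"
        by (simp add: cscale_cscale cscale_mult_right matrix_mul_assoc mult.commute)
      then show ?thesis by (simp add: cpow_mat_commute cscale_mult_left)
    qed
    moreover have "((- z) / ?c) *\<^sub>c A ** ?p s ** h s = - ((z / ?c) *\<^sub>c (A ** ?p s) ** h s)"
      by (simp add: vec_eq_iff cscale_mult_left)
    ultimately show "((\<lambda>s. ?p s ** h s) has_vector_derivative 0) (at s)" by simp
  qed (use t in auto)
  also have "h 0 = mat 1"
    unfolding h_def by (subst suminf_finite[of "{0}"]) (auto simp: binomial_coeff_mat_def cscale_eq_mat_mult)
  finally have "?p t ** h t = mat 1" by (simp add: cpow_mat_1)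
  then have "cpow_mat (1 - z * of_real t) (- A) ** ?p t ** h t = cpow_mat (1 - z * of_real t) (- A)"
    by (simp flip: matrix_mul_assoc)
  moreover have "cpow_mat (1 - z * of_real t) (- A) ** ?p t = mat 1"
    using cpow_mat_minus[of _ "- A"] by simp
  ultimately have "h t = cpow_mat (1 - z * of_real t) (- A)" by simp
  then show ?thesis using summable_sums[OF smu[OF t]] by (simp add: h_def)
qed

lemma has_vector_derivative_imp_continuous_on:
  assumes "\<And>t. t \<in> S \<Longrightarrow> (f has_vector_derivative f' t) (at t)"
  shows "continuous_on S f"
  by (intro continuous_at_imp_continuous_on ballI has_vector_derivative_continuous) (rule assms)

lemma continuous_on_cpow_mat:
  assumes "\<And>t. t \<in> S \<Longrightarrow> (c has_vector_derivative c' t) (at t)" "\<And>t. t \<in> S \<Longrightarrow> c t \<notin> \<real>\<^sub>\<le>\<^sub>0"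
  shows "continuous_on S (\<lambda>t. cpow_mat (c t) A)"
  by (rule has_vector_derivative_imp_continuous_on,
      rule cpow_mat_has_vector_derivative[OF assms(1)]) (use assms(2) in auto)

section \<open>The kernel of the extended beta function\<close>

definition ext_Beta_kernel ::
  "complex^'n^'n \<Rightarrow> complex^'n^'n \<Rightarrow> complex^'n^'n \<Rightarrow> complex^'n^'n \<Rightarrow> complex^'n^'n \<Rightarrow> real \<Rightarrow> complex^'n^'n"
  where
  "ext_Beta_kernel A B Y P Q t = hyp1F1_mat A B (- (Y /\<^sub>R (t * (1 - t))))
     ** cpow_mat (of_real t) (P - mat 1) ** cpow_mat (of_real (1 - t)) (Q - mat 1)"

text \<open>All beta functions in the series become moments of one kernel, so the summation over n
  meets only powers of t.\<close>

lemma ext_Beta_kernel_add_of_nat: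
  assumes "t > 0"
  shows "ext_Beta_kernel A B Y (P + mat (of_nat n)) Q t = t ^ n *\<^sub>R ext_Beta_kernel A B Y P Q t"
proof -
  have "P + mat (of_nat n) - mat 1 = (P - mat 1) + mat (of_nat n)" by simp
  then have "cpow_mat (of_real t) (P + mat (of_nat n) - mat 1) = t ^ n *\<^sub>R cpow_mat (of_real t) (P - mat 1)"
    using assms cpow_mat_add_of_nat[of "of_real t" "P - mat 1" n]
    by (simp only: of_real_power[symmetric] cscale_of_real) simp
  then show ?thesis
    by (simp add: ext_Beta_kernel_def mm.scaleR_left mm.scaleR_right)
qed

lemma continuous_on_ext_Beta_kernel:
  assumes "positive_stable B"
  shows "continuous_on {0<..<1} (ext_Beta_kernel A B Y P Q)"
proof -
  have "continuous_on {0<..<1} (\<lambda>t. hyp1F1_mat A B (- (inverse (t * (1 - t)) *\<^sub>R Y)))"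
    by (rule continuous_on_compose2[OF continuous_on_hyp1F1_mat[OF assms, of UNIV]])
      (auto intro!: continuous_intros)
  moreover have "continuous_on {0<..<1} (\<lambda>t. cpow_mat (complex_of_real t) (P - mat 1))"
    by (rule continuous_on_cpow_mat) (auto intro!: derivative_eq_intros)
  moreover have "continuous_on {0<..<1} (\<lambda>t. cpow_mat (complex_of_real (1 - t)) (Q - mat 1))"
    by (rule continuous_on_cpow_mat[where c' = "\<lambda>_. - 1"])
      (auto intro!: derivative_eq_intros simp: complex_nonpos_Reals_iff)
  ultimately show ?thesis
    unfolding ext_Beta_kernel_def[abs_def] by (intro mm.continuous_on)
qed

text \<open>The 1F1 factor contributes only a constant, so the majorant is a multiple of a scalar
  beta integrand.\<close>

lemma ext_Beta_kernel_bound: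
  fixes A B Y P Q :: "complex^'n^'n"
  assumes "positive_stable A" "positive_stable B" "positive_stable Y" "positive_stable P" "positive_stable Q"
  obtains b where "b integrable_on {0<..<1}"
    "\<And>t. 0 < t \<Longrightarrow> t < 1 \<Longrightarrow> norm (ext_Beta_kernel A B Y P Q t) \<le> b t"
proof -
  obtain K where K: "K > 0" "\<And>(A :: complex^'n^'n) (B :: complex^'n^'n). norm (A ** B) \<le> K * norm A * norm B"
    by (rule matrix_mult_norm_bound) blast
  obtain H where H: "\<And>s. s \<ge> 1 \<Longrightarrow> norm (hyp1F1_mat A B (- (s *\<^sub>R Y))) \<le> H"
    using hyp1F1_mat_bounded[OF assms(2,1,3)] by blast
  have H0: "H \<ge> 0" using H[of 1] norm_ge_zero order_trans by blast
  obtain C c where C: "C \<ge> 0" "c > 0"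
    "\<And>t::real. 0 < t \<Longrightarrow> t \<le> 1 \<Longrightarrow> norm (cpow_mat (of_real t) (P - mat 1)) \<le> C * t powr (c - 1)"
    using positive_stable_cpow_bound[OF assms(4)] by blast
  obtain D d where D: "D \<ge> 0" "d > 0"
    "\<And>t::real. 0 < t \<Longrightarrow> t \<le> 1 \<Longrightarrow> norm (cpow_mat (of_real t) (Q - mat 1)) \<le> D * t powr (d - 1)"
    using positive_stable_cpow_bound[OF assms(5)] by blast
  let ?b = "\<lambda>t::real. K * K * H * C * D * (t powr (c - 1) * (1 - t) powr (d - 1))"
  show thesis
  proof (rule that)
    have "(\<lambda>t. t powr (c - 1) * (1 - t) powr (d - 1)) integrable_on {0<..<1}"
      using has_integral_Beta_real[OF C(2) D(2)] unfolding has_integral_Icc_iff_Ioo by blast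
    then show "?b integrable_on {0<..<1}" by (rule integrable_on_mult_right)
    fix t :: real assume t: "0 < t" "t < 1"
    let ?h = "hyp1F1_mat A B (- (Y /\<^sub>R (t * (1 - t))))"
    let ?p = "cpow_mat (complex_of_real t) (P - mat 1)" and ?q = "cpow_mat (complex_of_real (1 - t)) (Q - mat 1)"
    \<comment> \<open>On (0, 1) the scale 1 / (t (1 - t)) stays in the range s >= 1 where
      1F1(A;B;-sY) is bounded.\<close>
    have "t * (1 - t) \<le> 1 * 1" using t by (intro mult_mono) auto
    then have "inverse (t * (1 - t)) \<ge> 1" using t by (intro one_le_inverse) auto
    then have h: "norm ?h \<le> H" by (rule H)
    have "norm (ext_Beta_kernel A B Y P Q t) \<le> K * norm (?h ** ?p) * norm ?q"
      unfolding ext_Beta_kernel_def by (rule K(2))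
    also have "\<dots> \<le> K * (K * norm ?h * norm ?p) * norm ?q"
      using K by (intro mult_right_mono mult_left_mono) auto
    also have "\<dots> \<le> K * (K * H * (C * t powr (c - 1))) * (D * (1 - t) powr (d - 1))"
      using K(1) H0 C(1) D(1) h C(3)[of t] D(3)[of "1 - t"] t
      by (intro mult_mono mult_nonneg_nonneg) auto
    also have "\<dots> = ?b t" by simp
    finally show "norm (ext_Beta_kernel A B Y P Q t) \<le> ?b t" .
  qed
qed

lemma absolutely_integrable_kernel_mult:
  fixes \<phi> K :: "real \<Rightarrow> complex^'n^'n"
  assumes "continuous_on {0<..<1} (\<lambda>t. \<phi> t ** K t)" and "b integrable_on {0<..<1}"
    and "\<And>t. 0 < t \<Longrightarrow> t < 1 \<Longrightarrow> norm (\<phi> t ** K t) \<le> b t"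
  shows "(\<lambda>t. \<phi> t ** K t) absolutely_integrable_on {0<..<1}"
  by (rule measurable_bounded_by_integrable_imp_absolutely_integrable[where g = b])
    (use assms in \<open>auto intro: continuous_imp_measurable_on_sets_lebesgue\<close>)

text \<open>The substitution t = u / (1 + u) has derivative 1 / (1 + u)^2. Prescribing
  \<open>g\<close> only for u > 0 lets the second integrand be inserted in its own form.\<close>

lemma mobius_substitution:
  fixes f g :: "real \<Rightarrow> 'a::euclidean_space"
  assumes "f absolutely_integrable_on {0<..<1}"
    and "\<And>u. u > 0 \<Longrightarrow> g u = inverse ((1 + u)\<^sup>2) *\<^sub>R f (u / (1 + u))"
  shows "g absolutely_integrable_on {0<..} \<and> integral {0<..} g = integral {0<..<1} f"
proof -
  let ?g = "\<lambda>u::real. \<bar>inverse ((1 + u)\<^sup>2)\<bar> *\<^sub>R f (u / (1 + u))"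
  have "(\<lambda>u::real. u / (1 + u)) ` {0<..} = {0<..<1}"
  proof (intro equalityI subsetI)
    fix t :: real assume "t \<in> {0<..<1}"
    then show "t \<in> (\<lambda>u::real. u / (1 + u)) ` {0<..}"
      by (intro image_eqI[where x = "t / (1 - t)"]) (auto simp: field_simps)
  qed (auto simp: field_simps)
  moreover have "?g absolutely_integrable_on {0<..} \<and> integral {0<..} ?g = integral {0<..<1} f
    \<longleftrightarrow> f absolutely_integrable_on (\<lambda>u. u / (1 + u)) ` {0<..} \<and>
      integral ((\<lambda>u. u / (1 + u)) ` {0<..}) f = integral {0<..<1} f"
    by (rule has_absolute_integral_change_of_variables_real)
      (auto intro!: derivative_eq_intros inj_onI simp: field_simps power2_eq_square)
  ultimately have "?g absolutely_integrable_on {0<..} \<and> integral {0<..} ?g = integral {0<..<1} f"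
    using assms(1) by simp
  moreover have "?g absolutely_integrable_on {0<..} \<longleftrightarrow> g absolutely_integrable_on {0<..}"
    by (rule set_integrable_cong) (use assms(2) in auto)
  moreover have "integral {0<..} ?g = integral {0<..} g"
    by (rule integral_cong) (use assms(2) in auto)
  ultimately show ?thesis by simp
qed

theorem theorem4p1:
  fixes A B A1 B1 C1 Y :: "complex^'n^'n" and z :: complex
  defines "f \<equiv> (\<lambda>t::real.
       cpow_mat (1 - z * of_real t) (- A1)
         ** hyp1F1_mat A B (- (Y /\<^sub>R (t * (1 - t))))
         ** cpow_mat (of_real t) (B1 - mat 1)
         ** cpow_mat (of_real (1 - t)) (C1 - B1 - mat 1))"
    and "g \<equiv> (\<lambda>u::real.
       cpow_mat (1 + of_real u * (1 - z)) (- A1)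
         ** cpow_mat (of_real (1 + u)) A1
         ** hyp1F1_mat A B (- (2 *\<^sub>R Y) - (u + 1 / u) *\<^sub>R Y)
         ** cpow_mat (of_real u) (B1 - mat 1)
         ** cpow_mat (of_real (1 + u)) (- C1))"
  assumes "positive_stable A" and "positive_stable B"
    and "positive_stable A1" and "positive_stable B1" and "positive_stable C1"
    and "positive_stable (C1 - B1)" and "positive_stable Y"
    and "B1 ** C1 = C1 ** B1"
    and "norm z < 1"
  shows "summable (ext_hyp2F1_term A B Y A1 B1 C1 z)
    \<and> f absolutely_integrable_on {0<..<1}
    \<and> ext_hyp2F1 A B Y A1 B1 C1 z
        = integral {0<..<1} f ** matrix_inv (Beta_mat B1 (C1 - B1))
    \<and> g absolutely_integrable_on {0<..}
    \<and> ext_hyp2F1 A B Y A1 B1 C1 z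
        = integral {0<..} g ** matrix_inv (Beta_mat B1 (C1 - B1))"
proof -
  let ?K = "ext_Beta_kernel A B Y B1 (C1 - B1)" and ?Z = "matrix_inv (Beta_mat B1 (C1 - B1))"
  let ?u = "binomial_coeff_mat A1 z"
  obtain k where k: "k > 0" "\<And>(A :: complex^'n^'n) (B :: complex^'n^'n). norm (A ** B) \<le> k * norm A * norm B"
    by (rule matrix_mult_norm_bound) blast
  obtain b where b: "b integrable_on {0<..<1}" "\<And>t. 0 < t \<Longrightarrow> t < 1 \<Longrightarrow> norm (?K t) \<le> b t"
    using ext_Beta_kernel_bound[OF \<open>positive_stable A\<close> \<open>positive_stable B\<close> \<open>positive_stable Y\<close>
        \<open>positive_stable B1\<close> \<open>positive_stable (C1 - B1)\<close>] by blast
  have contK: "continuous_on {0<..<1} ?K"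
    using \<open>positive_stable B\<close> by (rule continuous_on_ext_Beta_kernel)
  \<comment> \<open>A bound for all partial sums at every t in (0, 1), which makes k M b the
    dominating function.\<close>
  define M where "M = (\<Sum>n. norm (?u n))"
  have summ: "summable (\<lambda>n. norm (?u n))"
    using summable_binomial_coeff_mat[OF \<open>norm z < 1\<close>, of 1 A1] by simp
  define S where "S N t = (\<Sum>n<N. t ^ n *\<^sub>R ?u n)" for N and t :: real
  have S_le: "norm (S N t) \<le> M" if t: "0 < t" "t < 1" for N t
  proof -
    have "norm (S N t) \<le> (\<Sum>n<N. norm (?u n))"
      unfolding S_def using t by (intro sum_norm_le) (simp add: mult_left_le_one_le power_le_one)
    also have "\<dots> \<le> M" unfolding M_def by (intro sum_le_suminf summ) auto
    finally show ?thesis .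
  qed
  have f_eq: "f t = cpow_mat (1 - z * of_real t) (- A1) ** ?K t" for t
    by (simp add: f_def ext_Beta_kernel_def matrix_mul_assoc)
  have binom: "(\<lambda>N. S N t) \<longlonglongrightarrow> cpow_mat (1 - z * of_real t) (- A1)" if "0 < t" "t < 1" for t
    using binomial_series_mat[OF \<open>norm z < 1\<close>, of t A1] that unfolding sums_def S_def by simp
  have lim: "(\<lambda>N. S N t ** ?K t) \<longlonglongrightarrow> f t" if "0 < t" "t < 1" for t
    unfolding f_eq using that by (intro mm.tendsto binom tendsto_const)
  have bound: "norm (\<phi> ** ?K t) \<le> k * M * b t" if "norm \<phi> \<le> M" "0 < t" "t < 1" for \<phi> :: "complex^'n^'n" and t
  proof -
    have "norm (\<phi> ** ?K t) \<le> k * norm \<phi> * norm (?K t)" by (rule k(2))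
    also have "\<dots> \<le> k * M * b t"
      using k(1) that b(2)[OF that(2,3)] order_trans[OF norm_ge_zero that(1)]
      by (intro mult_mono mult_nonneg_nonneg) auto
    finally show ?thesis .
  qed
  have intb: "(\<lambda>t. k * M * b t) integrable_on {0<..<1}"
    using b(1) by (rule integrable_on_mult_right)

  have f_int: "f absolutely_integrable_on {0<..<1}"
    unfolding f_eq[abs_def]
  proof (rule absolutely_integrable_kernel_mult[OF _ intb])
    have "1 - z * complex_of_real t \<notin> \<real>\<^sub>\<le>\<^sub>0" if "t \<in> {0<..<1}" for t
      using norm_mult_of_real_less_1[OF \<open>norm z < 1\<close>, of t] that by (intro one_minus_not_nonpos_Reals) auto
    then have "continuous_on {0<..<1} (\<lambda>t. cpow_mat (1 - z * complex_of_real t) (- A1))"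
      by (intro continuous_on_cpow_mat[where c' = "\<lambda>_. - z"]) (auto intro!: derivative_eq_intros)
    then show "continuous_on {0<..<1} (\<lambda>t. cpow_mat (1 - z * complex_of_real t) (- A1) ** ?K t)"
      by (rule mm.continuous_on[OF _ contK])
    \<comment> \<open>The bound \<open>M\<close> passes from the partial sums to their
      limit.\<close>
    show "norm (cpow_mat (1 - z * complex_of_real t) (- A1) ** ?K t) \<le> k * M * b t" if t: "0 < t" "t < 1" for t
      by (rule bound[OF LIMSEQ_le_const2[OF tendsto_norm[OF binom[OF t]]] t]) (use S_le[OF t] in auto)
  qed
  have S_int: "(\<lambda>t. S N t ** ?K t) absolutely_integrable_on {0<..<1}" for N
    by (rule absolutely_integrable_kernel_mult[OF _ intb])
      (auto simp: S_def intro!: mm.continuous_on contK continuous_intros bound S_le[unfolded S_def])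
  \<comment> \<open>Finite sums go under the integral by linearity; dominated convergence then
    handles the limit in \<open>N\<close>.\<close>
  have partial: "(\<Sum>n<N. ext_hyp2F1_term A B Y A1 B1 C1 z n) = integral {0<..<1} (\<lambda>t. S N t ** ?K t) ** ?Z" for N
  proof -
    have pow_int: "(\<lambda>t. t ^ n *\<^sub>R ?K t) integrable_on {0<..<1}" for n
    proof (rule set_lebesgue_integral_eq_integral(1), rule measurable_bounded_by_integrable_imp_absolutely_integrable[where g = b])
      show "norm (t ^ n *\<^sub>R ?K t) \<le> b t" if "t \<in> {0<..<1}" for t
      proof -
        have "t ^ n * norm (?K t) \<le> 1 * norm (?K t)"
          using that by (intro mult_right_mono power_le_one) auto
        also have "\<dots> \<le> b t" using that b(2) by simp
        finally show ?thesis using that by simp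
      qed
    qed (auto intro!: continuous_imp_measurable_on_sets_lebesgue continuous_intros contK b)
    have "ext_hyp2F1_term A B Y A1 B1 C1 z n = integral {0<..<1} (\<lambda>t. ?u n ** (t ^ n *\<^sub>R ?K t)) ** ?Z" for n
    proof -
      have "ext_Beta_mat A B Y (B1 + mat (of_nat n)) (C1 - B1) = integral {0<..<1} (\<lambda>t. t ^ n *\<^sub>R ?K t)"
        unfolding ext_Beta_mat_def ext_Beta_kernel_def[symmetric]
        by (rule integral_cong) (simp add: ext_Beta_kernel_add_of_nat)
      then show ?thesis
        using integral_linear[OF pow_int[of n] mm.bounded_linear_right[of "?u n"]]
        by (simp add: ext_hyp2F1_term_def o_def) (simp add: binomial_coeff_mat_def cscale_mult_left)
    qed
    then have "(\<Sum>n<N. ext_hyp2F1_term A B Y A1 B1 C1 z n)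
        = (\<Sum>n<N. integral {0<..<1} (\<lambda>t. ?u n ** (t ^ n *\<^sub>R ?K t))) ** ?Z"
      by (simp add: mm.sum_left)
    also have "(\<Sum>n<N. integral {0<..<1} (\<lambda>t. ?u n ** (t ^ n *\<^sub>R ?K t)))
        = integral {0<..<1} (\<lambda>t. \<Sum>n<N. ?u n ** (t ^ n *\<^sub>R ?K t))"
      using integrable_linear[OF pow_int mm.bounded_linear_right]
      by (intro integral_sum[symmetric]) (auto simp: o_def)
    also have "(\<lambda>t. \<Sum>n<N. ?u n ** (t ^ n *\<^sub>R ?K t)) = (\<lambda>t. S N t ** ?K t)"
      by (simp add: S_def mm.sum_left mm.scaleR_left mm.scaleR_right)
    finally show ?thesis .
  qed
  have "(\<lambda>N. integral {0<..<1} (\<lambda>t. S N t ** ?K t)) \<longlonglongrightarrow> integral {0<..<1} f"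
  proof (rule dominated_convergence(2)[OF _ intb])
    show "(\<lambda>t. S N t ** ?K t) integrable_on {0<..<1}" for N
      using S_int by (rule set_lebesgue_integral_eq_integral(1))
    show "norm (S N t ** ?K t) \<le> k * M * b t" if "t \<in> {0<..<1}" for N t
      using that by (intro bound S_le) auto
    show "(\<lambda>N. S N t ** ?K t) \<longlonglongrightarrow> f t" if "t \<in> {0<..<1}" for t
      using that by (intro lim) auto
  qed
  then have sums: "ext_hyp2F1_term A B Y A1 B1 C1 z sums (integral {0<..<1} f ** ?Z)"
    unfolding sums_def partial by (intro mm.tendsto tendsto_const)

  have "g u = inverse ((1 + u)\<^sup>2) *\<^sub>R f (u / (1 + u))" if u: "u > 0" for u
  proof -
    let ?t = "u / (1 + u)" and ?v = "1 + u"
    let ?s = "1 + complex_of_real u * (1 - z)"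
    have v: "?v > 0" using u by simp
    then have v0: "complex_of_real ?v \<noteq> 0" unfolding of_real_eq_0_iff by simp
    have t: "complex_of_real ?t = of_real u * inverse (of_real ?v)"
      and t1: "complex_of_real (1 - ?t) = inverse (of_real ?v)"
      using v by (simp_all add: field_simps del: of_real_add flip: of_real_inverse of_real_mult)
    \<comment> \<open>Splitting the positive factor 1 / (1 + u) off the base requires the remaining
      factor to be nonzero.\<close>
    have "Re ?s > 0"
    proof -
      have "Re z < 1" using \<open>norm z < 1\<close> complex_Re_le_cmod[of z] by simp
      then have "u * (1 - Re z) > 0" using u by simp
      then show ?thesis by simp
    qed
    then have s0: "?s \<noteq> 0" by (metis less_irrefl zero_complex.simps(1))
    have s: "1 - z * of_real ?t = of_real (inverse ?v) * ?s"
      using v0 by (simp add: field_simps)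
    have p1: "cpow_mat (1 - z * of_real ?t) (- A1) = cpow_mat ?s (- A1) ** cpow_mat (of_real ?v) A1"
      unfolding s using cpow_mat_mult_of_real[of "inverse ?v" ?s "- A1"]
        cpow_mat_inverse_of_real[OF v, of "- A1"] s0 v by simp
    have p2: "cpow_mat (of_real ?t) (B1 - mat 1)
        = cpow_mat (of_real u) (B1 - mat 1) ** cpow_mat (of_real ?v) (mat 1 - B1)"
      using cpow_mat_mult_of_real[of "inverse ?v" "of_real u" "B1 - mat 1"]
        cpow_mat_inverse_of_real[OF v, of "B1 - mat 1"] u v unfolding t by (simp add: mult.commute)
    have p3: "cpow_mat (of_real (1 - ?t)) (C1 - B1 - mat 1) = cpow_mat (of_real ?v) (mat 1 + B1 - C1)"
      unfolding t1 cpow_mat_inverse_of_real[OF v] by (simp add: algebra_simps)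
    \<comment> \<open>Commutation of \<open>B1\<close> and \<open>C1\<close> permits adding the
      exponents of the two adjacent powers of 1 + u. The total is 2I - C1, and the resulting scalar
      (1 + u)^2 cancels the derivative of the substitution.\<close>
    have "(mat 1 - B1) ** (mat 1 + B1 - C1) = (mat 1 + B1 - C1) ** (mat 1 - B1)"
      using \<open>B1 ** C1 = C1 ** B1\<close> by (simp add: mm.add_left mm.add_right mm.diff_left mm.diff_right)
    then have "cpow_mat (of_real ?v) (mat 1 - B1) ** cpow_mat (of_real ?v) (mat 1 + B1 - C1)
        = cpow_mat (of_real ?v) ((mat 1 - B1) + (mat 1 + B1 - C1))"
      by (rule cpow_mat_add[symmetric])
    also have "(mat 1 - B1) + (mat 1 + B1 - C1) = - C1 + mat (of_nat 2)"
      by (simp add: vec_eq_iff mat_def)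
    also have "cpow_mat (of_real ?v) \<dots> = ?v\<^sup>2 *\<^sub>R cpow_mat (of_real ?v) (- C1)"
      by (simp only: cpow_mat_add_of_nat[OF v0] of_real_power[symmetric] cscale_of_real)
    finally have p4: "cpow_mat (of_real ?v) (mat 1 - B1) ** cpow_mat (of_real ?v) (mat 1 + B1 - C1)
        = ?v\<^sup>2 *\<^sub>R cpow_mat (of_real ?v) (- C1)" .
    have "1 - ?t = 1 / ?v" using v by (simp add: field_simps)
    then have "inverse (?t * (1 - ?t)) = ?v\<^sup>2 / u"
      by (simp only:) (simp add: power2_eq_square)
    also have "\<dots> = 2 + (u + 1 / u)"
      using u by (simp add: field_simps power2_eq_square)
    finally have h: "- (Y /\<^sub>R (?t * (1 - ?t))) = - (2 *\<^sub>R Y) - (u + 1 / u) *\<^sub>R Y"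
      by (simp add: scaleR_add_left)
    have "f ?t = cpow_mat ?s (- A1) ** cpow_mat (of_real ?v) A1
        ** hyp1F1_mat A B (- (2 *\<^sub>R Y) - (u + 1 / u) *\<^sub>R Y) ** cpow_mat (of_real u) (B1 - mat 1)
        ** (cpow_mat (of_real ?v) (mat 1 - B1) ** cpow_mat (of_real ?v) (mat 1 + B1 - C1))"
      unfolding f_def p1 p2 p3 h by (simp only: matrix_mul_assoc)
    also have "\<dots> = ?v\<^sup>2 *\<^sub>R g u"
      unfolding p4 by (simp only: g_def mm.scaleR_right)
    finally show ?thesis using v by simp
  qed
  from mobius_substitution[OF f_int this] sums f_int show ?thesis
    by (simp add: sums_iff ext_hyp2F1_def)
qed

end
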